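(* Let $h>0$, $T=lh$ with $l\in\mathbb{N}$, $\lambda,\mu\in\mathbb{R}$, $0<\beta<1$, $1<\alpha\le 2$, $\alpha-\beta>1$, and let $\varphi:[-h,T]\to\mathbb{R}$ be twice continuously differentiable. Let $f:[0,T]\times\mathbb{R}\to\mathbb{R}$ be a continuous function for which there exists $L_f>0$ such that $$|f(t,y)-f(t,z)|\le L_f|y-z|\qquad\text{for all }(t,y),(t,z)\in[0,T]\times\mathbb{R}.$$ Then the problem $$\begin{cases}{}^{RL}D_{-h^{+}}^{\alpha}y(t)-\lambda\ {}^{RL}D_{-h^{+}}^{\beta}y(t)=\mu\, y(t-h)+f(t,y(t)), & t\in(0,T],\\ y(t)=\varphi(t), & -h\le t\le 0,\\ (I_{-h^{+}}^{2-\alpha}y)(-h^{+})=\varphi(-h),\\ {}^{RL}D_{-h^{+}}^{\alpha-1}y(t)={}^{RL}D_{-h^{+}}^{\alpha-1}\varphi(t), & -h\le t\le 0,\\ ({}^{RL}D_{-h^{+}}^{\alpha-1}y)(-h^{+})={}^{RL}D_{-h^{+}}^{\alpha-1}\varphi(-h)\end{cases}$$ has a unique solution in $C([0,T],\mathbb{R})$.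
   Context: $C([0,T],\mathbb{R})$ is the Banach space of all continuous functions from $[0,T]$ into $\mathbb{R}$. Riemann-Liouville operators based at $-h$: for $\nu>0$, $(I_{-h^{+}}^{\nu}y)(t)=\frac{1}{\Gamma(\nu)}\int_{-h}^{t}(t-s)^{\nu-1}y(s)\,ds$, $I_{-h^{+}}^{0}y=y$, and ${}^{RL}D_{-h^{+}}^{\nu}y=\frac{d^{m}}{dt^{m}}I_{-h^{+}}^{m-\nu}y$ with $m=\lceil \nu\rceil$. Values of these at $-h$ or $-h^{+}$ are limits as $t\to -h^{+}$.
   Formalization: Adds the hypothesis that the derivative of order α−1 of φ has a finite limit at −h; for α<2 this means φ(−h)=0, without which that value is undefined and (I^{2−α}y)(−h⁺)=0≠φ(−h), so no solution exists. *)

theory Defs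
  imports "HOL-Analysis.Analysis"
begin

definition RL_integral :: "real \<Rightarrow> real \<Rightarrow> (real \<Rightarrow> real) \<Rightarrow> real \<Rightarrow> real" where
  "RL_integral a \<nu> y t =
     (if \<nu> = 0 then y t
      else 1 / Gamma \<nu> * integral {a..t} (\<lambda>s. (t - s) powr (\<nu> - 1) * y s))"

text \<open>Derivatives are taken within a set \<open>S\<close>, so that they are one-sided at a right end point
  belonging to \<open>S\<close> and two-sided in its interior. Since \<^const>\<open>vector_derivative\<close> is total,
  existence is recorded separately by \<open>times_differentiable\<close>.\<close>

definition deriv_within :: "real set \<Rightarrow> (real \<Rightarrow> real) \<Rightarrow> real \<Rightarrow> real" where
  "deriv_within S g t = vector_derivative g (at t within S)"

primrec times_differentiable :: "real set \<Rightarrow> nat \<Rightarrow> (real \<Rightarrow> real) \<Rightarrow> real \<Rightarrow> bool" where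
  "times_differentiable S 0 g t \<longleftrightarrow> True"
| "times_differentiable S (Suc n) g t \<longleftrightarrow>
     (\<forall>\<^sub>F s in nhds t. s \<in> S \<longrightarrow> times_differentiable S n g s) \<and>
     ((deriv_within S ^^ n) g) differentiable (at t within S)"

text \<open>Riemann--Liouville derivative, based at \<open>a\<close>, of a function living on \<open>[a, b]\<close>. It is meant
  for \<open>a < t \<le> b\<close>; its value at \<open>a\<close> is always expressed as a limit along \<^term>\<open>at_right a\<close>.\<close>

definition RL_deriv :: "real \<Rightarrow> real \<Rightarrow> real \<Rightarrow> (real \<Rightarrow> real) \<Rightarrow> real \<Rightarrow> real" where
  "RL_deriv a b \<nu> y =
     (let m = nat \<lceil>\<nu>\<rceil> in (deriv_within {a<..b} ^^ m) (RL_integral a (real m - \<nu>) y))"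

definition RL_differentiable :: "real \<Rightarrow> real \<Rightarrow> real \<Rightarrow> (real \<Rightarrow> real) \<Rightarrow> real \<Rightarrow> bool" where
  "RL_differentiable a b \<nu> y t \<longleftrightarrow>
     (let m = nat \<lceil>\<nu>\<rceil> in times_differentiable {a<..b} m (RL_integral a (real m - \<nu>) y) t)"

definition twice_cont_differentiable_on :: "real set \<Rightarrow> (real \<Rightarrow> real) \<Rightarrow> bool" where
  "twice_cont_differentiable_on S g \<longleftrightarrow>
     (\<exists>g' g''. (\<forall>t\<in>S. (g has_real_derivative g' t) (at t within S)) \<and>
               (\<forall>t\<in>S. (g' has_real_derivative g'' t) (at t within S)) \<and>
               continuous_on S g'')"

text \<open>The condition on the derivative of order \<open>\<alpha> - 1\<close> is imposed on \<open>[-h, 0]\<close>: for \<open>t > -h\<close> by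
  the fourth and fifth conjuncts, for \<open>t = -h\<close> by the last one, where both values are limits. At \<open>t = 0\<close>
  the derivative of \<open>y\<close> is two-sided if \<open>T > 0\<close>, so this condition couples \<open>y\<close> on \<open>(0, T]\<close> with
  the history \<open>\<phi>\<close>. For \<open>\<alpha> < 2\<close> the limit \<open>d\<close> exists only if \<open>\<phi> (-h) = 0\<close>; for such \<open>\<alpha>\<close> the condition
  on \<open>RL_integral\<close> also forces \<open>\<phi> (-h) = 0\<close>, since \<open>y = \<phi>\<close> is bounded near \<open>-h\<close>.\<close>

definition delay_problem_solution ::
  "real \<Rightarrow> real \<Rightarrow> real \<Rightarrow> real \<Rightarrow> real \<Rightarrow> real \<Rightarrow> (real \<Rightarrow> real) \<Rightarrow> (real \<Rightarrow> real \<Rightarrow> real) \<Rightarrow>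
     (real \<Rightarrow> real) \<Rightarrow> bool" where
  "delay_problem_solution h T \<alpha> \<beta> lam \<mu> \<phi> f y \<longleftrightarrow>
     (\<forall>t\<in>{0<..T}. RL_differentiable (-h) T \<alpha> y t \<and> RL_differentiable (-h) T \<beta> y t \<and>
        RL_deriv (-h) T \<alpha> y t - lam * RL_deriv (-h) T \<beta> y t = \<mu> * y (t - h) + f t (y t)) \<and>
     (\<forall>t\<in>{-h..0}. y t = \<phi> t) \<and>
     (RL_integral (-h) (2 - \<alpha>) y \<longlongrightarrow> \<phi> (-h)) (at_right (-h)) \<and>
     (\<forall>t\<in>{-h<..0}. RL_differentiable (-h) T (\<alpha> - 1) y t) \<and>
     (\<forall>t\<in>{-h<..0}. RL_deriv (-h) T (\<alpha> - 1) y t = RL_deriv (-h) T (\<alpha> - 1) \<phi> t) \<and>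
     (\<exists>d. (RL_deriv (-h) T (\<alpha> - 1) \<phi> \<longlongrightarrow> d) (at_right (-h)) \<and>
          (RL_deriv (-h) T (\<alpha> - 1) y \<longlongrightarrow> d) (at_right (-h)))"

end

theory Submission
  imports Defs
begin

text \<open>
  Write \<open>I\<^sup>\<nu>\<close> for the Riemann--Liouville integral based at \<open>0\<close> and let \<open>z = y - \<phi>\<close>, which vanishes on
  \<open>[-h, 0]\<close>. Each integral of \<open>y\<close> based at \<open>-h\<close> then splits into that of the given function \<open>\<phi>\<close>, which can
  be differentiated explicitly away from \<open>-h\<close>, and \<open>I\<^sup>\<nu> z\<close>. In terms of \<open>z\<close> the equation says
  that for \<open>t > 0\<close> the derivative of \<open>(I\<^bsup>2-\<alpha>\<^esup> z)' - lam * I\<^bsup>1-\<beta>\<^esup> z\<close> is a continuous function \<open>G\<close> of \<open>t\<close>, \<open>z\<close> and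
  the delayed \<open>z\<close> (lemma \<open>solution_imp_fixed_point\<close>). Two integrations give
  \<open>I\<^bsup>2-\<alpha>\<^esup> z = lam * I\<^bsup>2-\<beta>\<^esup> z + I\<^sup>2 G\<close>. The first constant of integration is zero because the condition on
  the derivative of order \<open>\<alpha> - 1\<close> at \<open>0\<close> forces \<open>(I\<^bsup>2-\<alpha>\<^esup> z)' 0 = 0\<close>, the second because \<open>z\<close> is continuous
  with \<open>z 0 = 0\<close>. Applying \<open>I\<^bsup>\<alpha>-1\<^esup>\<close>, using the semigroup law \<open>I\<^sup>\<mu> I\<^sup>\<nu> = I\<^bsup>\<mu>+\<nu>\<^esup>\<close>, and differentiating once,
  one arrives at the Volterra equation \<open>z = lam * I\<^bsup>\<alpha>-\<beta>\<^esup> z + I\<^sup>\<alpha> G\<close>. All these steps can be reversed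
  (\<open>fixed_point_imp_solution\<close>); for the derivative of order \<open>\<beta>\<close> one substitutes the Volterra equation into
  \<open>I\<^bsup>1-\<beta>\<^esup> z\<close>, which raises the orders of integration above \<open>1\<close>.

  Since \<open>\<alpha> - \<beta> > 1\<close> and \<open>\<alpha> > 1\<close>, both kernels of the Volterra equation are bounded, and \<open>G\<close> is Lipschitz in
  \<open>z\<close>. Hence the right hand side is a contraction for the supremum norm with weight \<open>exp (- \<gamma> t)\<close> once
  \<open>\<gamma>\<close> is large (\<open>picard_contracts\<close>); the delay does no harm because the bound \<open>exp (\<gamma> t)\<close> increases with
  \<open>t\<close>. Banach's theorem on the whole of \<open>[0, T]\<close> gives existence and uniqueness together, so that the
  intervals between multiples of \<open>h\<close> need not be treated one after the other.

  The two facts about \<open>I\<^sup>\<nu>\<close> that are not formal, continuity of \<open>I\<^sup>\<nu> y\<close> and the semigroup law, follow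
  from the Beta integral for powers of \<open>s - a\<close> and pass to continuous functions by uniform approximation with
  polynomials.
\<close>

section \<open>Riemann--Liouville integrals of continuous functions\<close>

text \<open>The substitution \<open>s = a + (t - a) x\<close> turns this into the Beta integral over the unit interval.\<close>

lemma powr_kernel_has_integral:
  fixes a t \<nu> p :: real
  assumes "0 < \<nu>" "-1 < p" "a \<le> t"
  shows "((\<lambda>s. (t - s) powr (\<nu> - 1) * (s - a) powr p) has_integral
           Beta (p + 1) \<nu> * (t - a) powr (p + \<nu>)) {a..t}"
proof (cases "a = t")
  case True
  then show ?thesis using assms by (simp add: has_integral_refl)
next
  case False
  with assms have d: "0 < t - a" by simp
  have *: "((\<lambda>x. x powr p * (1 - x) powr (\<nu> - 1)) has_integral Beta (p + 1) \<nu>) (cbox 0 (1::real))"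
    using has_integral_Beta_real[of "p + 1" \<nu>] assms by simp
  have e0: "(t - a) * (1 + a / (t - a)) = t" using d by (simp add: distrib_left)
  from has_integral_affinity'[OF *, of "1 / (t - a)" "- a / (t - a)"] d
  have "((\<lambda>s. (s / (t - a) - a / (t - a)) powr p * (1 - (s / (t - a) - a / (t - a))) powr (\<nu> - 1))
          has_integral (t - a) * Beta (p + 1) \<nu>) {a..t}"
    by (simp add: mult_ac e0)
  from has_integral_mult_right[OF this, of "(t - a) powr (p + \<nu> - 1)"]
  have *: "((\<lambda>s. (t - a) powr (p + \<nu> - 1) * ((s / (t - a) - a / (t - a)) powr p *
      (1 - (s / (t - a) - a / (t - a))) powr (\<nu> - 1)))
          has_integral (t - a) powr (p + \<nu> - 1) * ((t - a) * Beta (p + 1) \<nu>)) {a..t}" .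
  have e1: "(t - a) powr (p + \<nu> - 1) * ((t - a) * Beta (p + 1) \<nu>) = Beta (p + 1) \<nu> * (t - a) powr (p + \<nu>)"
    using d by (simp add: powr_diff)
  have e2: "(t - a) powr (p + \<nu> - 1) * ((s / (t - a) - a / (t - a)) powr p *
      (1 - (s / (t - a) - a / (t - a))) powr (\<nu> - 1)) = (t - s) powr (\<nu> - 1) * (s - a) powr p"
    if "s \<in> {a..t}" for s
  proof -
    have "s / (t - a) - a / (t - a) = (s - a) / (t - a)" by (simp add: diff_divide_distrib)
    moreover have "1 - (s - a) / (t - a) = (t - s) / (t - a)" using d by (simp add: field_simps)
    moreover have "(t - a) powr (p + \<nu> - 1) = (t - a) powr p * (t - a) powr (\<nu> - 1)"
      by (simp flip: powr_add add: algebra_simps)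
    ultimately show ?thesis using d that by (simp add: powr_divide)
  qed
  show ?thesis
    using has_integral_eq[OF e2 *] unfolding e1 .
qed

text \<open>The kernel is nonnegative and integrable, hence absolutely integrable, and stays so when multiplied by
  a bounded measurable function.\<close>

lemma kernel_integrable:
  fixes a t \<nu> :: real
  assumes "0 < \<nu>" "continuous_on {a..t} y"
  shows "(\<lambda>s. (t - s) powr (\<nu> - 1) * y s) integrable_on {a..t}"
proof (cases "a \<le> t")
  case True
  have "(\<lambda>s. (t - s) powr (\<nu> - 1)) integrable_on {a..t}"
  proof -
    have "((\<lambda>s. (t - s) powr (\<nu> - 1) * (s - a) powr 0) has_integral
           Beta (0 + 1) \<nu> * (t - a) powr (0 + \<nu>)) {a..t}"
      using assms True by (intro powr_kernel_has_integral) auto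
    then have "(\<lambda>s. (t - s) powr (\<nu> - 1) * (s - a) powr 0) integrable_on {a..t}"
      by (auto simp: integrable_on_def)
    then show ?thesis
      by (rule integrable_spike_finite[of "{a}", rotated 2]) auto
  qed
  then have k: "(\<lambda>s. (t - s) powr (\<nu> - 1)) absolutely_integrable_on {a..t}"
    by (intro nonnegative_absolutely_integrable_1) auto
  have "(\<lambda>s. y s * (t - s) powr (\<nu> - 1)) absolutely_integrable_on {a..t}"
  proof (rule absolutely_integrable_bounded_measurable_product_real[OF _ _ _ k])
    show "y \<in> borel_measurable (lebesgue_on {a..t})"
      using assms(2) by (intro continuous_imp_measurable_on_sets_lebesgue) auto
    show "bounded (y ` {a..t})"
      using assms(2) compact_continuous_image compact_imp_bounded by blast
  qed auto
  then show ?thesis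
    by (simp add: mult.commute absolutely_integrable_on_def)
qed auto

lemma RL_integral_0 [simp]: "RL_integral a 0 y = y"
  by (simp add: RL_integral_def fun_eq_iff)

lemma RL_integral_add:
  assumes "0 \<le> \<nu>" "continuous_on {a..t} y" "continuous_on {a..t} z"
  shows "RL_integral a \<nu> (\<lambda>s. y s + z s) t = RL_integral a \<nu> y t + RL_integral a \<nu> z t"
proof (cases "\<nu> = 0")
  case False
  then have n: "0 < \<nu>" using assms by simp
  then show ?thesis
    using integral_add[OF kernel_integrable[OF n assms(2)] kernel_integrable[OF n assms(3)]]
    by (simp add: RL_integral_def ring_distribs add_divide_distrib)
qed simp

lemma RL_integral_cmult: "RL_integral a \<nu> (\<lambda>s. c * y s) t = c * RL_integral a \<nu> y t"
proof -
  have "(\<lambda>s. (t - s) powr (\<nu> - 1) * (c * y s)) = (\<lambda>s. c * ((t - s) powr (\<nu> - 1) * y s))"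
    by (simp add: fun_eq_iff mult_ac)
  then show ?thesis by (simp add: RL_integral_def)
qed

lemma RL_integral_diff:
  assumes "0 \<le> \<nu>" "continuous_on {a..t} y" "continuous_on {a..t} z"
  shows "RL_integral a \<nu> (\<lambda>s. y s - z s) t = RL_integral a \<nu> y t - RL_integral a \<nu> z t"
  using RL_integral_add[OF assms(1,2), of "\<lambda>s. (-1) * z s"] assms(3)
  RL_integral_cmult[of a \<nu> "-1" z t] by (simp add: continuous_on_minus)

lemma RL_integral_sum:
  assumes "0 \<le> \<nu>" "finite I" "\<And>i. i \<in> I \<Longrightarrow> continuous_on {a..t} (y i)"
  shows "RL_integral a \<nu> (\<lambda>s. \<Sum>i\<in>I. y i s) t = (\<Sum>i\<in>I. RL_integral a \<nu> (y i) t)"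
  using assms(2,3)
proof (induction I)
  case empty
  then show ?case by (simp add: RL_integral_def)
next
  case (insert i I)
  then show ?case using assms(1) by (simp add: RL_integral_add continuous_on_sum)
qed

lemma RL_integral_cong_except:
  assumes "0 < \<nu>" "finite N" "\<And>s. s \<in> {a..t} - N \<Longrightarrow> y s = z s"
  shows "RL_integral a \<nu> y t = RL_integral a \<nu> z t"
proof -
  have "integral {a..t} (\<lambda>s. (t - s) powr (\<nu> - 1) * y s) = integral {a..t} (\<lambda>s. (t - s) powr (\<nu> - 1) * z s)"
    using assms by (intro integral_spike[of N]) (auto simp: negligible_finite)
  then show ?thesis using assms(1) by (simp add: RL_integral_def)
qed

lemma RL_integral_cong:
  assumes "a \<le> t" "\<And>s. s \<in> {a..t} \<Longrightarrow> y s = z s"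
  shows "RL_integral a \<nu> y t = RL_integral a \<nu> z t"
proof -
  have "integral {a..t} (\<lambda>s. (t - s) powr (\<nu> - 1) * y s) = integral {a..t} (\<lambda>s. (t - s) powr (\<nu> - 1) * z s)"
    using assms by (intro integral_cong) auto
  then show ?thesis using assms by (simp add: RL_integral_def)
qed

lemma RL_integral_start [simp]: "0 < \<nu> \<Longrightarrow> RL_integral a \<nu> y a = 0"
  by (simp add: RL_integral_def)

lemma RL_integral_powr:
  assumes "0 < \<nu>" "-1 < p" "a \<le> t"
  shows "RL_integral a \<nu> (\<lambda>s. (s - a) powr p) t = Gamma (p + 1) / Gamma (p + \<nu> + 1) * (t - a) powr (p + \<nu>)"
proof -
  have "0 < Gamma \<nu>" using assms(1) by (rule Gamma_real_pos)
  then have "Gamma \<nu> \<noteq> 0" by simp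
  then show ?thesis
    using integral_unique[OF powr_kernel_has_integral[OF assms]] assms(1)
    by (auto simp: RL_integral_def Beta_def add_ac)
qed

lemma RL_integral_power:
  assumes "0 < \<nu>" "a \<le> t"
  shows "RL_integral a \<nu> (\<lambda>s. (s - a) ^ i) t = fact i / Gamma (real i + \<nu> + 1) * (t - a) powr (real i + \<nu>)"
proof -
  \<comment> \<open>The exceptional point is \<open>a\<close>, because \<open>0 ^ 0 = 1\<close> but \<open>0 powr 0 = 0\<close>.\<close>
  have "RL_integral a \<nu> (\<lambda>s. (s - a) ^ i) t = RL_integral a \<nu> (\<lambda>s. (s - a) powr real i) t"
    using assms by (intro RL_integral_cong_except[of _ "{a}"]) (auto simp: powr_realpow)
  then show ?thesis using assms RL_integral_powr[of \<nu> "real i" a t] Gamma_fact[of i, where 'a=real]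
    by (simp add: add_ac)
qed

lemma RL_integral_const:
  assumes "0 < \<nu>" "a \<le> t"
  shows "RL_integral a \<nu> (\<lambda>s. c) t = c * (t - a) powr \<nu> / Gamma (\<nu> + 1)"
  using RL_integral_power[OF assms, of 0] RL_integral_cmult[of a \<nu> c "\<lambda>s. 1" t] by simp

lemma RL_integral_bound:
  assumes "0 < \<nu>" "continuous_on {a..t} y" "continuous_on {a..t} g" "\<And>s. s \<in> {a..t} \<Longrightarrow> \<bar>y s\<bar> \<le> g s"
  shows "\<bar>RL_integral a \<nu> y t\<bar> \<le> RL_integral a \<nu> g t"
proof -
  have "norm (integral {a..t} (\<lambda>s. (t - s) powr (\<nu> - 1) * y s)) \<le> integral {a..t} (\<lambda>s. (t - s) powr (\<nu> - 1) * g s)"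
    using assms by (intro integral_norm_bound_integral kernel_integrable)
      (auto simp: abs_mult intro!: mult_left_mono)
  then show ?thesis
    using Gamma_real_pos[OF assms(1)] assms(1)
    by (simp add: RL_integral_def abs_mult divide_right_mono)
qed

lemma RL_integral_bound_const:
  assumes "0 < \<nu>" "a \<le> t" "t \<le> b" "continuous_on {a..t} y" "\<And>s. s \<in> {a..t} \<Longrightarrow> \<bar>y s\<bar> \<le> e"
  shows "\<bar>RL_integral a \<nu> y t\<bar> \<le> e * ((b - a) powr \<nu> / Gamma (\<nu> + 1))"
proof -
  have "0 \<le> e" using assms(2) assms(5)[of a] by fastforce
  moreover have "0 < Gamma (\<nu> + 1)" using assms(1) by (intro Gamma_real_pos) simp
  moreover have "\<bar>RL_integral a \<nu> y t\<bar> \<le> e * (t - a) powr \<nu> / Gamma (\<nu> + 1)"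
    using RL_integral_bound[of \<nu> a t y "\<lambda>s. e"] RL_integral_const[OF assms(1,2), of e] assms by simp
  moreover have "(t - a) powr \<nu> \<le> (b - a) powr \<nu>"
    using assms by (intro powr_mono2) auto
  ultimately show ?thesis
    by (smt (verit) divide_right_mono mult_left_mono times_divide_eq_right)
qed

text \<open>Powers are centred at the base point of the integral because the integrals of \<open>(s - a) ^ i\<close> based
  at \<open>a\<close> are again single powers.\<close>

lemma approx_by_power_sum:
  fixes y :: "real \<Rightarrow> real"
  assumes "continuous_on {a..b} y" "0 < e"
  obtains c n where "\<And>s. s \<in> {a..b} \<Longrightarrow> \<bar>y s - (\<Sum>i\<le>n::nat. c i * (s - a) ^ i)\<bar> < e"
proof -
  have "continuous_on {0..b - a} (\<lambda>s. y (s + a))"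
    by (rule continuous_on_compose2[OF assms(1)]) (auto intro!: continuous_intros)
  then obtain g where g: "real_polynomial_function g" "\<And>x. x \<in> {0..b - a} \<Longrightarrow> \<bar>y (x + a) - g x\<bar> < e"
    using Stone_Weierstrass_real_polynomial_function[OF compact_Icc _ assms(2)] by blast
  then obtain c n where "g = (\<lambda>x. \<Sum>i\<le>n. c i * x ^ i)"
    by (auto simp: real_polynomial_function_iff_sum)
  with g(2)[of "_ - a"] show thesis by (intro that[of c n]) auto
qed

text \<open>For a polynomial the integral is a sum of powers with positive exponents. By \<open>RL_integral_bound_const\<close>
  the integral depends continuously on the integrand in the supremum norm, so in general it is a uniform limit
  of such sums.\<close>

lemma continuous_on_RL_integral:
  assumes "0 \<le> \<nu>" "continuous_on {a..b} y"
  shows "continuous_on {a..b} (RL_integral a \<nu> y)"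
proof (cases "\<nu> = 0")
  case False
  then have n: "0 < \<nu>" using assms by simp
  define C where "C = (b - a) powr \<nu> / Gamma (\<nu> + 1)"
  have C: "0 \<le> C" using n by (auto simp: C_def intro!: divide_nonneg_nonneg less_imp_le[OF Gamma_real_pos])
  have "\<exists>g. continuous_on {a..b} g \<and> (\<forall>t\<in>{a..b}. \<bar>RL_integral a \<nu> y t - g t\<bar> \<le> 1 / real (Suc k) * C)" for k
  proof -
    have "0 < 1 / real (Suc k)" by simp
    from approx_by_power_sum[OF assms(2) this] obtain c m
      where c: "\<And>s. s \<in> {a..b} \<Longrightarrow> \<bar>y s - (\<Sum>i\<le>m::nat. c i * (s - a) ^ i)\<bar> < 1 / real (Suc k)"
      by metis
    let ?g = "\<lambda>t. \<Sum>i\<le>m. c i * (fact i / Gamma (real i + \<nu> + 1) * (t - a) powr (real i + \<nu>))"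
    have "continuous_on {a..b} ?g"
      using n by (intro continuous_intros continuous_on_powr') auto
    moreover have "\<bar>RL_integral a \<nu> y t - ?g t\<bar> \<le> 1 / real (Suc k) * C" if t: "t \<in> {a..b}" for t
    proof -
      have ct: "continuous_on {a..t} y" using assms(2) t by (auto elim: continuous_on_subset)
      have cs: "continuous_on {a..t} (\<lambda>s. \<Sum>i\<le>m::nat. c i * (s - a) ^ i)" by (intro continuous_intros)
      have "RL_integral a \<nu> (\<lambda>s. \<Sum>i\<le>m. c i * (s - a) ^ i) t = ?g t"
        using n t by (subst RL_integral_sum) (auto intro!: continuous_intros simp: RL_integral_cmult RL_integral_power)
      moreover have "RL_integral a \<nu> (\<lambda>s. y s - (\<Sum>i\<le>m. c i * (s - a) ^ i)) t
          = RL_integral a \<nu> y t - RL_integral a \<nu> (\<lambda>s. \<Sum>i\<le>m. c i * (s - a) ^ i) t"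
        using n by (intro RL_integral_diff ct cs) auto
      moreover have "\<bar>RL_integral a \<nu> (\<lambda>s. y s - (\<Sum>i\<le>m. c i * (s - a) ^ i)) t\<bar> \<le> 1 / real (Suc k) * C"
        unfolding C_def using n t c by (intro RL_integral_bound_const continuous_on_diff ct cs) (auto intro: less_imp_le)
      ultimately show ?thesis by simp
    qed
    ultimately show ?thesis by blast
  qed
  then obtain g where g: "\<And>k. continuous_on {a..b} (g k)"
    "\<And>k t. t \<in> {a..b} \<Longrightarrow> \<bar>RL_integral a \<nu> y t - g k t\<bar> \<le> 1 / real (Suc k) * C"
    by metis
  have "uniform_limit {a..b} g (RL_integral a \<nu> y) sequentially"
  proof (rule uniform_limitI)
    fix e :: real assume "0 < e"
    have "(\<lambda>k. 1 / real (Suc k) * C) \<longlonglongrightarrow> 0"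
      using tendsto_mult_left_zero[OF LIMSEQ_inverse_real_of_nat, of C] by (simp add: field_simps)
    then have "\<forall>\<^sub>F k in sequentially. 1 / real (Suc k) * C < e"
      using \<open>0 < e\<close> by (rule order_tendstoD)
    then show "\<forall>\<^sub>F k in sequentially. \<forall>t\<in>{a..b}. dist (g k t) (RL_integral a \<nu> y t) < e"
    proof eventually_elim
      case (elim k)
      then show ?case using g(2)[of _ k] by (force simp: dist_real_def abs_minus_commute)
    qed
  qed
  then show ?thesis
    using g(1) by (intro uniform_limit_theorem[where F = sequentially]) auto
qed (use assms in simp)

text \<open>Both sides agree on powers of \<open>s - a\<close>, by the quotients of Gamma values in \<open>RL_integral_powr\<close>. Both sides
  are bounded in the supremum norm, with joint constant \<open>K\<close>, so they agree on continuous functions by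
  density of the polynomials. No interchange of integrals is involved.\<close>

lemma RL_integral_RL_integral_pos:
  assumes m: "0 < \<mu>" and n: "0 < \<nu>" and y: "continuous_on {a..b} y" and t: "t \<in> {a..b}"
  shows "RL_integral a \<mu> (RL_integral a \<nu> y) t = RL_integral a (\<mu> + \<nu>) y t"
proof -
  have sub: "continuous_on {a..s} g" if "s \<in> {a..b}" "continuous_on {a..b} g" for s and g :: "real \<Rightarrow> real"
    using that by (auto elim: continuous_on_subset)
  define K where "K = (b - a) powr \<nu> / Gamma (\<nu> + 1) * ((b - a) powr \<mu> / Gamma (\<mu> + 1))
    + (b - a) powr (\<mu> + \<nu>) / Gamma (\<mu> + \<nu> + 1)"
  have "\<bar>RL_integral a \<mu> (RL_integral a \<nu> y) t - RL_integral a (\<mu> + \<nu>) y t\<bar> \<le> e * K" if e: "0 < e" for e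
  proof -
    from approx_by_power_sum[OF y e] obtain c k
      where c: "\<And>s. s \<in> {a..b} \<Longrightarrow> \<bar>y s - (\<Sum>i\<le>k::nat. c i * (s - a) ^ i)\<bar> < e" by metis
    define g where "g = (\<lambda>s. \<Sum>i\<le>k::nat. c i * (s - a) ^ i)"
    define r where "r = (\<lambda>s. y s - g s)"
    have cg: "continuous_on {a..b} g" unfolding g_def by (intro continuous_intros)
    have cr: "continuous_on {a..b} r" unfolding r_def by (intro continuous_intros y cg)
    have rb: "\<bar>r s\<bar> \<le> e" if "s \<in> {a..b}" for s using c[OF that] by (simp add: r_def g_def)
    have split: "RL_integral a \<rho> y s = RL_integral a \<rho> r s + RL_integral a \<rho> g s"
      if "0 < \<rho>" "s \<in> {a..b}" for \<rho> s
    proof -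
      have "RL_integral a \<rho> y s = RL_integral a \<rho> (\<lambda>s. r s + g s) s" by (simp add: r_def)
      also have "\<dots> = RL_integral a \<rho> r s + RL_integral a \<rho> g s"
        using that by (intro RL_integral_add sub[OF _ cr] sub[OF _ cg]) auto
      finally show ?thesis .
    qed
    have ga: "RL_integral a \<rho> g s = (\<Sum>i\<le>k. c i * (fact i / Gamma (real i + \<rho> + 1) * (s - a) powr (real i + \<rho>)))"
      if "0 < \<rho>" "s \<in> {a..b}" for \<rho> s
      unfolding g_def using that
      by (subst RL_integral_sum) (auto intro!: continuous_intros simp: RL_integral_cmult RL_integral_power)
    have "RL_integral a \<mu> (RL_integral a \<nu> y) t = RL_integral a \<mu> (\<lambda>s. RL_integral a \<nu> r s + RL_integral a \<nu> g s) t"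
      using t n by (intro RL_integral_cong) (auto simp: split)
    also have "\<dots> = RL_integral a \<mu> (RL_integral a \<nu> r) t + RL_integral a \<mu> (RL_integral a \<nu> g) t"
      using m n by (intro RL_integral_add sub[OF t continuous_on_RL_integral] cr cg) auto
    also have "RL_integral a \<mu> (RL_integral a \<nu> g) t = RL_integral a (\<mu> + \<nu>) g t"
    proof -
      define d where "d = (\<lambda>i. c i * fact i / Gamma (real i + \<nu> + 1))"
      have "0 < Gamma (real i + \<nu> + 1)" for i using n by (intro Gamma_real_pos) simp
      then have G: "Gamma (real i + \<nu> + 1) \<noteq> 0" for i by (simp add: order_less_imp_not_eq2)
      have "RL_integral a \<mu> (RL_integral a \<nu> g) t
          = RL_integral a \<mu> (\<lambda>s. \<Sum>i\<le>k. d i * (s - a) powr (real i + \<nu>)) t"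
        using t n by (intro RL_integral_cong) (auto simp: ga d_def mult.assoc)
      also have "\<dots> = (\<Sum>i\<le>k. RL_integral a \<mu> (\<lambda>s. d i * (s - a) powr (real i + \<nu>)) t)"
        using m n by (intro RL_integral_sum) (auto intro!: continuous_intros continuous_on_powr')
      also have "\<dots> = (\<Sum>i\<le>k. d i * (Gamma (real i + \<nu> + 1) / Gamma (real i + \<nu> + \<mu> + 1) *
          (t - a) powr (real i + \<nu> + \<mu>)))"
        using m n t by (simp add: RL_integral_cmult RL_integral_powr)
      also have "\<dots> = RL_integral a (\<mu> + \<nu>) g t"
        using ga[of "\<mu> + \<nu>" t] m n t G by (simp add: d_def add_ac)
      finally show ?thesis .
    qed
    finally have "RL_integral a \<mu> (RL_integral a \<nu> y) t - RL_integral a (\<mu> + \<nu>) y t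
        = RL_integral a \<mu> (RL_integral a \<nu> r) t - RL_integral a (\<mu> + \<nu>) r t"
      using split[of "\<mu> + \<nu>" t] m n t by simp
    moreover have "\<bar>RL_integral a \<mu> (RL_integral a \<nu> r) t\<bar> \<le>
        e * ((b - a) powr \<nu> / Gamma (\<nu> + 1)) * ((b - a) powr \<mu> / Gamma (\<mu> + 1))"
    proof (rule RL_integral_bound_const[OF m])
      show "\<bar>RL_integral a \<nu> r s\<bar> \<le> e * ((b - a) powr \<nu> / Gamma (\<nu> + 1))" if "s \<in> {a..t}" for s
        using that t rb by (intro RL_integral_bound_const n sub[OF _ cr]) auto
      show "continuous_on {a..t} (RL_integral a \<nu> r)"
        using n by (intro sub[OF t continuous_on_RL_integral] cr) auto
    qed (use t in auto)
    moreover have "\<bar>RL_integral a (\<mu> + \<nu>) r t\<bar> \<le> e * ((b - a) powr (\<mu> + \<nu>) / Gamma (\<mu> + \<nu> + 1))"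
      using t m n rb by (intro RL_integral_bound_const sub[OF t cr]) auto
    ultimately show ?thesis unfolding K_def by (simp add: ring_distribs mult.assoc)
  qed
  note le = this
  have "\<bar>RL_integral a \<mu> (RL_integral a \<nu> y) t - RL_integral a (\<mu> + \<nu>) y t\<bar> \<le> 0"
  proof (rule field_le_epsilon)
    fix e :: real assume "0 < e"
    have K: "0 \<le> K" unfolding K_def using m n
      by (intro add_nonneg_nonneg mult_nonneg_nonneg divide_nonneg_nonneg less_imp_le[OF Gamma_real_pos]) auto
    have "e / (K + 1) * K \<le> e" using K \<open>0 < e\<close> by (simp add: field_simps)
    then show "\<bar>RL_integral a \<mu> (RL_integral a \<nu> y) t - RL_integral a (\<mu> + \<nu>) y t\<bar> \<le> 0 + e"
      using le[of "e / (K + 1)"] K \<open>0 < e\<close> by simp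
  qed
  then show ?thesis by simp
qed

lemma RL_integral_RL_integral:
  assumes "0 \<le> \<mu>" "0 \<le> \<nu>" "continuous_on {a..b} y" "t \<in> {a..b}"
  shows "RL_integral a \<mu> (RL_integral a \<nu> y) t = RL_integral a (\<mu> + \<nu>) y t"
  using assms RL_integral_RL_integral_pos[of \<mu> \<nu> a b y t]
  by (cases "\<mu> = 0"; cases "\<nu> = 0") auto

lemma RL_integral_1: "RL_integral a 1 y t = integral {a..t} y"
proof -
  have "integral {a..t} (\<lambda>s. (t - s) powr (1 - 1) * y s) = integral {a..t} y"
    by (rule integral_spike[of "{t}"]) auto
  then show ?thesis by (simp add: RL_integral_def)
qed

lemma RL_integral_1_has_derivative:
  assumes "continuous_on {a..b} y" "t \<in> {a..b}"
  shows "(RL_integral a 1 y has_real_derivative y t) (at t within {a..b})"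
  using integral_has_real_derivative[OF assms] by (simp add: RL_integral_1[abs_def])

lemma RL_integral_shift_base:
  assumes "a \<le> b" "0 < \<nu>" "\<And>s. s \<le> b \<Longrightarrow> y s = 0"
  shows "RL_integral a \<nu> y t = RL_integral b \<nu> y t"
proof -
  have "integral {a..t} (\<lambda>s. (t - s) powr (\<nu> - 1) * y s) = integral {b..t} (\<lambda>s. (t - s) powr (\<nu> - 1) * y s)"
    unfolding integral_restrict_UNIV[symmetric, of "{a..t}"] integral_restrict_UNIV[symmetric, of "{b..t}"]
    using assms by (intro arg_cong[where f = "integral UNIV"] ext) auto
  then show ?thesis by (simp add: RL_integral_def)
qed

lemma RL_integral_before_start: "0 < \<nu> \<Longrightarrow> t \<le> a \<Longrightarrow> RL_integral a \<nu> y t = 0"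
  by (cases "t = a") (auto simp: RL_integral_def)

lemma at_within_greaterThanAtMost_eq:
  fixes a c b t :: real
  assumes "a \<le> c" "c < t"
  shows "at t within {c..b} = at t within {a<..b}"
  by (rule at_within_nhd[of _ "{c<..}"]) (use assms in auto)

text \<open>Integrate \<open>y = y a + I\<^sup>1 y'\<close> and commute \<open>I\<^sup>\<nu>\<close> with \<open>I\<^sup>1\<close> by the semigroup law. The point \<open>a\<close> is
  excluded because the first summand is \<open>0\<close> there for \<open>\<nu> = 0\<close>, by the convention \<open>0 powr 0 = 0\<close>.\<close>

lemma RL_integral_of_C1:
  assumes d: "\<And>s. s \<in> {a..b} \<Longrightarrow> (y has_real_derivative y' s) (at s within {a..b})"
    and c: "continuous_on {a..b} y'" and "0 \<le> \<nu>" and t: "t \<in> {a<..b}"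
  shows "RL_integral a \<nu> y t = y a / Gamma (\<nu> + 1) * (t - a) powr \<nu> + RL_integral a 1 (RL_integral a \<nu> y') t"
proof -
  have y: "y s = y a + RL_integral a 1 y' s" if s: "s \<in> {a..b}" for s
  proof -
    have "(y' has_integral (y s - y a)) {a..s}"
      using s by (intro fundamental_theorem_of_calculus)
        (auto intro: has_vector_derivative_within_subset d simp flip: has_real_derivative_iff_has_vector_derivative
          intro!: DERIV_subset[OF d])
    then show ?thesis by (simp add: RL_integral_1 integral_unique)
  qed
  show ?thesis
  proof (cases "\<nu> = 0")
    case True
    then show ?thesis using y[of t] t by simp
  next
    case False
    then have n: "0 < \<nu>" using assms by simp
    have ct: "continuous_on {a..t} y'" using c t by (auto elim: continuous_on_subset)
    have "RL_integral a \<nu> y t = RL_integral a \<nu> (\<lambda>s. y a + RL_integral a 1 y' s) t"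
      using t by (intro RL_integral_cong) (auto intro: y)
    also have "\<dots> = RL_integral a \<nu> (\<lambda>s. y a) t + RL_integral a \<nu> (RL_integral a 1 y') t"
      using n by (intro RL_integral_add continuous_on_RL_integral ct) auto
    also have "RL_integral a \<nu> (RL_integral a 1 y') t = RL_integral a 1 (RL_integral a \<nu> y') t"
      using t n by (simp add: RL_integral_RL_integral[OF _ _ c] add.commute)
    finally show ?thesis using n t by (simp add: RL_integral_const)
  qed
qed

text \<open>The coefficient is written \<open>\<nu> / Gamma (\<nu> + 1)\<close> rather than \<open>1 / Gamma \<nu>\<close> so that the formula visibly
  includes \<open>\<nu> = 0\<close>, where the singular term is absent.\<close>

lemma RL_integral_of_C1_has_derivative:
  assumes d: "\<And>s. s \<in> {a..b} \<Longrightarrow> (y has_real_derivative y' s) (at s within {a..b})"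
    and c: "continuous_on {a..b} y'" and n: "0 \<le> \<nu>" and t: "t \<in> {a<..b}"
  shows "(RL_integral a \<nu> y has_real_derivative
           \<nu> * y a / Gamma (\<nu> + 1) * (t - a) powr (\<nu> - 1) + RL_integral a \<nu> y' t) (at t within {a<..b})"
proof -
  have "(RL_integral a 1 (RL_integral a \<nu> y') has_real_derivative RL_integral a \<nu> y' t) (at t within {a<..b})"
    using t n by (intro DERIV_subset[OF RL_integral_1_has_derivative[of a b]] continuous_on_RL_integral c) auto
  moreover have "((\<lambda>s. (s - a) powr \<nu>) has_real_derivative \<nu> * (t - a) powr (\<nu> - 1)) (at t within {a<..b})"
    using t by (auto intro!: derivative_eq_intros)
  from DERIV_cmult[OF this, of "y a / Gamma (\<nu> + 1)"]
  have "((\<lambda>s. y a / Gamma (\<nu> + 1) * (s - a) powr \<nu>) has_real_derivative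
      \<nu> * y a / Gamma (\<nu> + 1) * (t - a) powr (\<nu> - 1)) (at t within {a<..b})"
    by (simp add: mult_ac)
  ultimately have "((\<lambda>s. y a / Gamma (\<nu> + 1) * (s - a) powr \<nu> + RL_integral a 1 (RL_integral a \<nu> y') s)
     has_real_derivative \<nu> * y a / Gamma (\<nu> + 1) * (t - a) powr (\<nu> - 1) + RL_integral a \<nu> y' t) (at t within {a<..b})"
    by (intro DERIV_add) auto
  then show ?thesis
    by (rule has_field_derivative_transform_within[where d = 1])
      (use t RL_integral_of_C1[OF d c n] in auto)
qed

section \<open>Riemann--Liouville derivatives of orders at most two\<close>

text \<open>Derivatives within \<open>{a<..b}\<close> are unique, also at the right end point; this links \<open>deriv_within\<close> with
  \<open>has_real_derivative\<close>, in which all computations are done.\<close>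

lemma deriv_within_eq:
  assumes "(g has_real_derivative D) (at t within {a<..b})" "t \<in> {a<..b}"
  shows "deriv_within {a<..b} g t = D"
proof -
  define c where "c = (a + t) / 2"
  have c: "at t within {a<..b} = at t within {c..b}"
    using assms(2) by (intro at_within_greaterThanAtMost_eq[symmetric]) (auto simp: c_def)
  have "at t within {c..b} \<noteq> bot"
    using assms(2) islimpt_Icc[of c b t] by (simp add: trivial_limit_within c_def)
  then show ?thesis using assms(1)
    unfolding deriv_within_def has_real_derivative_iff_has_vector_derivative c
    by (rule vector_derivative_within)
qed

lemma has_derivative_deriv_within:
  "g differentiable (at t within S) \<Longrightarrow> (g has_real_derivative deriv_within S g t) (at t within S)"
  by (simp add: deriv_within_def vector_derivative_works has_real_derivative_iff_has_vector_derivative)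

lemma has_real_derivative_imp_differentiable:
  "(g has_real_derivative D) (at t within S) \<Longrightarrow> g differentiable (at t within S)" for g :: "real \<Rightarrow> real"
  by (auto simp: has_real_derivative_iff_has_vector_derivative intro: differentiableI_vector)

lemma nat_ceiling_eq_1: "0 < x \<Longrightarrow> x \<le> 1 \<Longrightarrow> nat \<lceil>x\<rceil> = 1" for x :: real
  by (subst ceiling_unique[of 1]) auto

lemma nat_ceiling_eq_2: "1 < x \<Longrightarrow> x \<le> 2 \<Longrightarrow> nat \<lceil>x\<rceil> = 2" for x :: real
  by (subst ceiling_unique[of 2]) auto

lemma RL_deriv_order_1:
  assumes "0 < \<nu>" "\<nu> \<le> 1"
  shows "RL_differentiable a b \<nu> y t \<longleftrightarrow> RL_integral a (1 - \<nu>) y differentiable (at t within {a<..b})"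
    and "RL_deriv a b \<nu> y t = deriv_within {a<..b} (RL_integral a (1 - \<nu>) y) t"
  using nat_ceiling_eq_1[OF assms] by (simp_all add: RL_differentiable_def RL_deriv_def)

lemma RL_deriv_order_2:
  assumes "1 < \<nu>" "\<nu> \<le> 2"
  shows "RL_differentiable a b \<nu> y t \<longleftrightarrow>
      (\<forall>\<^sub>F s in nhds t. s \<in> {a<..b} \<longrightarrow> RL_integral a (2 - \<nu>) y differentiable (at s within {a<..b})) \<and>
      deriv_within {a<..b} (RL_integral a (2 - \<nu>) y) differentiable (at t within {a<..b})"
    and "RL_deriv a b \<nu> y t = deriv_within {a<..b} (deriv_within {a<..b} (RL_integral a (2 - \<nu>) y)) t"
  using nat_ceiling_eq_2[OF assms] by (simp_all add: RL_differentiable_def RL_deriv_def numeral_2_eq_2)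

lemma continuous_on_powr_shift:
  fixes a b p :: real
  shows "continuous_on {a<..b} (\<lambda>t. (t - a) powr p)"
  by (intro continuous_intros) auto

text \<open>The term \<open>(t - a) powr (\<nu> - 1)\<close> blows up at \<open>a\<close>, so a finite limit is possible only if its
  coefficient is zero. To see this, multiply by \<open>(t - a) powr (1 - \<nu>)\<close>, which tends to \<open>0\<close>. This is how the compatibility
  condition \<open>\<phi> (-h) = 0\<close> is extracted from the existence of the limit of the derivative of order \<open>\<alpha> - 1\<close>.\<close>

lemma vanishes_if_RL_deriv_limit:
  assumes ab: "a < b" and d: "\<And>s. s \<in> {a..b} \<Longrightarrow> (y has_real_derivative y' s) (at s within {a..b})"
    and c: "continuous_on {a..b} y'" and \<nu>: "0 < \<nu>" "\<nu> < 1"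
    and lim: "((\<lambda>t. \<nu> * y a / Gamma (\<nu> + 1) * (t - a) powr (\<nu> - 1) + RL_integral a \<nu> y' t) \<longlongrightarrow> d) (at_right a)"
  shows "y a = 0"
proof -
  have "((\<lambda>t. (t - a) powr (1 - \<nu>)) \<longlongrightarrow> 0 powr (1 - \<nu>)) (at_right a)"
    by (rule tendsto_powr') (use \<nu> in \<open>auto intro!: tendsto_eq_intros simp: eventually_at_right_less eventually_at_filter\<close>)
  moreover have "(RL_integral a \<nu> y' \<longlongrightarrow> 0) (at_right a)"
    using continuous_on_RL_integral[OF _ c, of \<nu>] ab \<nu>
    by (auto simp: continuous_on_def at_within_Icc_at_right dest!: bspec[of _ _ a])
  ultimately have "((\<lambda>t. (t - a) powr (1 - \<nu>) * (\<nu> * y a / Gamma (\<nu> + 1) * (t - a) powr (\<nu> - 1)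
      + RL_integral a \<nu> y' t - RL_integral a \<nu> y' t)) \<longlongrightarrow> 0 powr (1 - \<nu>) * (d - 0)) (at_right a)"
    by (intro tendsto_mult tendsto_diff lim)
  then have "((\<lambda>t. (t - a) powr (1 - \<nu>) * (\<nu> * y a / Gamma (\<nu> + 1) * (t - a) powr (\<nu> - 1)
      + RL_integral a \<nu> y' t - RL_integral a \<nu> y' t)) \<longlongrightarrow> 0) (at_right a)"
    by simp
  then have "((\<lambda>t. \<nu> * y a / Gamma (\<nu> + 1)) \<longlongrightarrow> 0) (at_right a)"
  proof (rule Lim_transform_eventually)
    show "\<forall>\<^sub>F t in at_right a. (t - a) powr (1 - \<nu>) * (\<nu> * y a / Gamma (\<nu> + 1) * (t - a) powr (\<nu> - 1)
      + RL_integral a \<nu> y' t - RL_integral a \<nu> y' t) = \<nu> * y a / Gamma (\<nu> + 1)"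
      using eventually_at_right_less
    proof eventually_elim
      case (elim t)
      then have "(t - a) powr (1 - \<nu>) * (t - a) powr (\<nu> - 1) = 1" by (simp flip: powr_add)
      then show ?case by (simp add: mult.left_commute[of "(t - a) powr (1 - \<nu>)"])
    qed
  qed
  then have "\<nu> * y a / Gamma (\<nu> + 1) = 0" by (simp add: tendsto_const_iff)
  moreover have "0 < Gamma (\<nu> + 1)" using \<nu> by (intro Gamma_real_pos) simp
  ultimately show ?thesis using \<nu> by simp
qed

section \<open>Fixed points of Volterra operators\<close>

text \<open>For orders above \<open>1\<close> the kernel is bounded, so integration gains a factor \<open>1 / \<gamma>\<close> against the
  weight \<open>exp (\<gamma> s)\<close>.\<close>

lemma exp_weighted_RL_bound:
  fixes \<nu> b \<gamma> C :: real
  assumes n: "1 < \<nu>" and g: "0 < \<gamma>" and t: "t \<in> {0..b}" and y: "continuous_on {0..t} y"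
    and C: "\<And>s. s \<in> {0..t} \<Longrightarrow> \<bar>y s\<bar> \<le> C * exp (\<gamma> * s)"
  shows "\<bar>RL_integral 0 \<nu> y t\<bar> \<le> b powr (\<nu> - 1) / Gamma \<nu> * (C / \<gamma> * exp (\<gamma> * t))"
proof -
  have G: "0 < Gamma \<nu>" using n by (intro Gamma_real_pos) simp
  have C0: "0 \<le> C" using C[of 0] t by (auto intro: order_trans[OF abs_ge_zero])
  have e: "((\<lambda>s. b powr (\<nu> - 1) * (C * exp (\<gamma> * s))) has_integral
      (b powr (\<nu> - 1) * (C / \<gamma> * exp (\<gamma> * t)) - b powr (\<nu> - 1) * (C / \<gamma> * exp (\<gamma> * 0)))) {0..t}"
    using t g by (intro fundamental_theorem_of_calculus)
      (auto intro!: derivative_eq_intros simp flip: has_real_derivative_iff_has_vector_derivative)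
  have "norm (integral {0..t} (\<lambda>s. (t - s) powr (\<nu> - 1) * y s)) \<le> integral {0..t} (\<lambda>s. b powr (\<nu> - 1) * (C * exp (\<gamma> * s)))"
  proof (rule integral_norm_bound_integral)
    show "(\<lambda>s. (t - s) powr (\<nu> - 1) * y s) integrable_on {0..t}"
      using n y by (intro kernel_integrable) auto
    show "(\<lambda>s. b powr (\<nu> - 1) * (C * exp (\<gamma> * s))) integrable_on {0..t}"
      using e by (rule has_integral_integrable)
    show "norm ((t - s) powr (\<nu> - 1) * y s) \<le> b powr (\<nu> - 1) * (C * exp (\<gamma> * s))" if "s \<in> {0..t}" for s
      using that t n C[OF that] by (auto simp: abs_mult intro!: mult_mono powr_mono2)
  qed
  also have "\<dots> \<le> b powr (\<nu> - 1) * (C / \<gamma> * exp (\<gamma> * t))"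
    using integral_unique[OF e] C0 g by simp
  finally have "\<bar>integral {0..t} (\<lambda>s. (t - s) powr (\<nu> - 1) * y s)\<bar> / Gamma \<nu>
      \<le> b powr (\<nu> - 1) * (C / \<gamma> * exp (\<gamma> * t)) / Gamma \<nu>"
    using G by (intro divide_right_mono) auto
  then show ?thesis
    using G n by (simp add: RL_integral_def abs_mult mult_ac)
qed

text \<open>Banach's theorem for the norm \<open>sup \<bar>z t\<bar> * exp (- \<gamma> t)\<close> on continuous functions on \<open>[0, T]\<close>. Such
  functions are represented by bounded continuous functions on the whole line, a complete space: multiply by
  the weight and clamp the argument to \<open>[0, T]\<close>.\<close>

lemma weighted_contraction_fixed_point:
  fixes \<Phi> :: "(real \<Rightarrow> real) \<Rightarrow> real \<Rightarrow> real"
  assumes T: "0 \<le> T"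
    and cont: "\<And>z. continuous_on {0..T} z \<Longrightarrow> continuous_on {0..T} (\<Phi> z)"
    and contr: "\<And>z w C t. continuous_on {0..T} z \<Longrightarrow> continuous_on {0..T} w \<Longrightarrow>
        (\<And>s. s \<in> {0..T} \<Longrightarrow> \<bar>z s - w s\<bar> \<le> C * exp (\<gamma> * s)) \<Longrightarrow> t \<in> {0..T} \<Longrightarrow>
        \<bar>\<Phi> z t - \<Phi> w t\<bar> \<le> C / 2 * exp (\<gamma> * t)"
  shows "\<exists>z. continuous_on {0..T} z \<and> (\<forall>t\<in>{0..T}. \<Phi> z t = z t)"
    and "continuous_on {0..T} z \<Longrightarrow> continuous_on {0..T} w \<Longrightarrow> (\<And>t. t \<in> {0..T} \<Longrightarrow> \<Phi> z t = z t) \<Longrightarrow>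
      (\<And>t. t \<in> {0..T} \<Longrightarrow> \<Phi> w t = w t) \<Longrightarrow> t \<in> {0..T} \<Longrightarrow> z t = w t"
proof -
  define p where "p = (\<lambda>t. max 0 (min T t))"
  have p: "p t \<in> {0..T}" "t \<in> {0..T} \<Longrightarrow> p t = t" for t using T by (auto simp: p_def)
  have pc: "continuous_on UNIV p" unfolding p_def by (intro continuous_intros)
  have bc: "(\<lambda>t. z (p t)) \<in> bcontfun" if z: "continuous_on {0..T} z" for z :: "real \<Rightarrow> real"
  proof -
    have "bounded (z ` {0..T})" using z compact_continuous_image compact_imp_bounded by blast
    then have "bounded (range (\<lambda>t. z (p t)))" by (rule bounded_subset) (use p in auto)
    moreover have "continuous_on UNIV (\<lambda>t. z (p t))"
      by (rule continuous_on_compose2[OF z pc]) (use p in auto)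
    ultimately show ?thesis by (simp add: bcontfun_def)
  qed
  define up where "up = (\<lambda>X :: real \<Rightarrow>\<^sub>C real. \<lambda>t. exp (\<gamma> * t) * apply_bcontfun X t)"
  define dn where "dn = (\<lambda>z. Bcontfun (\<lambda>t. exp (- \<gamma> * p t) * z (p t)))"
  have up: "continuous_on {0..T} (up X)" for X
    unfolding up_def by (intro continuous_intros) auto
  have dn: "apply_bcontfun (dn z) t = exp (- \<gamma> * p t) * z (p t)" if "continuous_on {0..T} z" for z t
    unfolding dn_def
  proof (subst Bcontfun_inverse)
    show "(\<lambda>t. exp (- \<gamma> * p t) * z (p t)) \<in> bcontfun"
      by (rule bc) (intro continuous_intros that)
  qed simp
  have ee: "exp (- \<gamma> * s) * (exp (\<gamma> * s) * x) = x" "exp (\<gamma> * s) * (exp (- \<gamma> * s) * x) = x" for s x :: real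
    by (simp_all add: mult.assoc[symmetric] flip: exp_add)
  have "\<exists>!X. dn (\<Phi> (up X)) = X"
  proof (rule banach_fix_type[of "1/2"])
    show "\<forall>X Y. dist (dn (\<Phi> (up X))) (dn (\<Phi> (up Y))) \<le> 1 / 2 * dist X Y"
    proof (intro allI dist_bound)
      fix X Y t
      have "\<bar>up X s - up Y s\<bar> \<le> dist X Y * exp (\<gamma> * s)" for s
      proof -
        have "up X s - up Y s = (apply_bcontfun X s - apply_bcontfun Y s) * exp (\<gamma> * s)"
          by (simp add: up_def algebra_simps)
        then show ?thesis
          using dist_bounded[of X s Y] by (simp add: dist_real_def abs_mult)
      qed
      from contr[OF up up this p(1)] 
      have "\<bar>\<Phi> (up X) (p t) - \<Phi> (up Y) (p t)\<bar> \<le> dist X Y / 2 * exp (\<gamma> * p t)" .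
      then have "exp (- \<gamma> * p t) * \<bar>\<Phi> (up X) (p t) - \<Phi> (up Y) (p t)\<bar> \<le>
          exp (- \<gamma> * p t) * (exp (\<gamma> * p t) * (dist X Y / 2))"
        by (intro mult_left_mono) (auto simp: mult.commute)
      then show "dist (apply_bcontfun (dn (\<Phi> (up X))) t) (apply_bcontfun (dn (\<Phi> (up Y))) t) \<le> 1 / 2 * dist X Y"
        unfolding ee by (simp add: dn cont up dist_real_def abs_mult flip: right_diff_distrib)
    qed
  qed auto
  then obtain X where X: "dn (\<Phi> (up X)) = X" and uniq: "\<And>Y. dn (\<Phi> (up Y)) = Y \<Longrightarrow> Y = X" by blast
  have "\<Phi> (up X) t = up X t" if "t \<in> {0..T}" for t
  proof -
    have "apply_bcontfun X t = exp (- \<gamma> * t) * \<Phi> (up X) t"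
      using dn[OF cont[OF up], of X t] p(2)[OF that] unfolding X by simp
    then have "up X t = exp (\<gamma> * t) * (exp (- \<gamma> * t) * \<Phi> (up X) t)" by (simp add: up_def)
    then show ?thesis unfolding ee by simp
  qed
  then show "\<exists>z. continuous_on {0..T} z \<and> (\<forall>t\<in>{0..T}. \<Phi> z t = z t)" using up by blast
  have dn_unique: "dn z = X" if z: "continuous_on {0..T} z" and f: "\<And>t. t \<in> {0..T} \<Longrightarrow> \<Phi> z t = z t" for z
  proof (rule uniq)
    have u: "up (dn z) t = z t" if "t \<in> {0..T}" for t
      unfolding up_def dn[OF z] p(2)[OF that] by (rule ee)
    have "\<Phi> (up (dn z)) t = \<Phi> z t" if "t \<in> {0..T}" for t
      using contr[OF up z, of "dn z" 0 t] u that by simp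
    then show "dn (\<Phi> (up (dn z))) = dn z"
      using f p(1) by (simp add: dn_def)
  qed
  show "z t = w t" if "continuous_on {0..T} z" "continuous_on {0..T} w" "\<And>t. t \<in> {0..T} \<Longrightarrow> \<Phi> z t = z t"
      "\<And>t. t \<in> {0..T} \<Longrightarrow> \<Phi> w t = w t" "t \<in> {0..T}" for z w t
  proof -
    have "dn z = dn w" using dn_unique that by simp
    then have "apply_bcontfun (dn z) t = apply_bcontfun (dn w) t" by simp
    then show ?thesis using that by (simp add: dn p(2))
  qed
qed

section \<open>Functions extended by zero to the left of the origin\<close>

text \<open>The value at \<open>0\<close> is also replaced by \<open>0\<close>, so that the extension vanishes on all of \<open>{..0}\<close>
  and the base point of its integrals can be moved freely to the left. It is applied to functions with \<open>z 0 = 0\<close>, so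
  that no jump arises.\<close>

definition zero_extension :: "(real \<Rightarrow> real) \<Rightarrow> real \<Rightarrow> real" where
  "zero_extension z t = (if 0 < t then z t else 0)"

lemma continuous_on_zero_extension:
  assumes "continuous_on {0..b} z" "z 0 = 0"
  shows "continuous_on {a..b} (zero_extension z)"
proof -
  have "continuous_on ({..0} \<union> {0..b}) (\<lambda>t. if t \<le> 0 then 0 else z t)"
    using assms by (intro continuous_on_If) auto
  moreover have "zero_extension z = (\<lambda>t. if t \<le> 0 then 0 else z t)" by (auto simp: zero_extension_def)
  ultimately show ?thesis by (auto elim: continuous_on_subset)
qed

lemma RL_integral_zero_extension:
  assumes "a \<le> 0" "0 \<le> \<nu>" "z 0 = 0"
  shows "RL_integral a \<nu> (zero_extension z) t = zero_extension (RL_integral 0 \<nu> z) t"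
proof (cases "\<nu> = 0")
  case False
  then have n: "0 < \<nu>" using assms by simp
  have "RL_integral a \<nu> (zero_extension z) t = RL_integral 0 \<nu> (zero_extension z) t"
    using assms n by (intro RL_integral_shift_base) (auto simp: zero_extension_def)
  also have "\<dots> = zero_extension (RL_integral 0 \<nu> z) t"
  proof (cases "0 < t")
    case True
    then show ?thesis using n assms(3) by (auto simp: zero_extension_def intro!: RL_integral_cong)
  qed (use n in \<open>auto simp: zero_extension_def RL_integral_before_start\<close>)
  finally show ?thesis .
qed simp

lemma zero_extension_has_derivative:
  assumes "(z has_real_derivative D) (at t within {0..b})" "0 < t" "t \<le> b" "a \<le> 0"
  shows "(zero_extension z has_real_derivative D) (at t within {a<..b})"
proof -
  have "(z has_real_derivative D) (at t within {a<..b})"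
    using assms(1) at_within_greaterThanAtMost_eq[of a 0 t b] assms by (cases "a = 0") (auto intro: DERIV_subset)
  then show ?thesis
    by (rule has_field_derivative_transform_within[where d = t])
      (use assms in \<open>auto simp: zero_extension_def dist_real_def\<close>)
qed

section \<open>Equivalence of the delay problem with a Volterra equation\<close>

text \<open>The history \<open>\<phi>\<close> enters the argument only through two derivatives \<open>P1\<close>, \<open>P2\<close> of its integral of order
  \<open>2 - \<alpha>\<close> and one derivative \<open>Q1\<close> of its integral of order \<open>1 - \<beta>\<close>, away from \<open>-h\<close>, and through two limits at \<open>-h\<close>.
  Thus \<open>P2\<close> and \<open>Q1\<close> are the Riemann--Liouville derivatives of \<open>\<phi>\<close> of orders \<open>\<alpha>\<close> and \<open>\<beta>\<close>.\<close>

locale delay_equation =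
  fixes h T \<alpha> \<beta> lam \<mu> L :: real and \<phi> P1 P2 Q1 :: "real \<Rightarrow> real" and f :: "real \<Rightarrow> real \<Rightarrow> real"
  assumes h: "0 < h" and T: "0 \<le> T"
    and \<beta>: "0 < \<beta>" "\<beta> < 1" and \<alpha>: "\<alpha> \<le> 2" and \<alpha>\<beta>: "1 < \<alpha> - \<beta>"
    and \<phi>_cont: "continuous_on {-h..T} \<phi>"
    and P1: "\<And>t. t \<in> {-h<..T} \<Longrightarrow>
      (RL_integral (-h) (2 - \<alpha>) \<phi> has_real_derivative P1 t) (at t within {-h<..T})"
    and P2: "\<And>t. t \<in> {-h<..T} \<Longrightarrow> (P1 has_real_derivative P2 t) (at t within {-h<..T})"
    and P2_cont: "continuous_on {-h<..T} P2"
    and Q1: "\<And>t. t \<in> {-h<..T} \<Longrightarrow>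
      (RL_integral (-h) (1 - \<beta>) \<phi> has_real_derivative Q1 t) (at t within {-h<..T})"
    and Q1_cont: "continuous_on {-h<..T} Q1"
    and lim_integral: "(RL_integral (-h) (2 - \<alpha>) \<phi> \<longlongrightarrow> \<phi> (-h)) (at_right (-h))"
    and lim_deriv: "\<exists>d. (P1 \<longlongrightarrow> d) (at_right (-h))"
    and f_cont: "continuous_on ({0..T} \<times> UNIV) (\<lambda>(t, x). f t x)"
    and L: "0 < L" and f_Lipschitz: "\<And>t x z. t \<in> {0..T} \<Longrightarrow> \<bar>f t x - f t z\<bar> \<le> L * \<bar>x - z\<bar>"
begin

lemma \<alpha>1: "1 < \<alpha>" using \<alpha>\<beta> \<beta> by simp

text \<open>The function \<open>G\<close> of the introduction: the right hand side of the equation minus the contribution of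
  \<open>\<phi>\<close> to the left hand side. For \<open>t < h\<close> the delayed argument lies in the history, where \<open>z\<close> should be
  \<open>0\<close>; it is replaced by \<open>z 0\<close>, which has the same value for solutions and keeps the function continuous for
  every continuous \<open>z\<close>.\<close>

definition forcing :: "(real \<Rightarrow> real) \<Rightarrow> real \<Rightarrow> real" where
  "forcing z t = lam * Q1 t - P2 t + \<mu> * (\<phi> (t - h) + z (max 0 (t - h))) + f t (\<phi> t + z t)"

definition picard :: "(real \<Rightarrow> real) \<Rightarrow> real \<Rightarrow> real" where
  "picard z t = lam * RL_integral 0 (\<alpha> - \<beta>) z t + RL_integral 0 \<alpha> (forcing z) t"

lemma continuous_on_forcing:
  assumes z: "continuous_on {0..T} z"
  shows "continuous_on {0..T} (forcing z)"
proof -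
  have sub: "{0..T} \<subseteq> {-h<..T}" using h by auto
  have \<phi>: "continuous_on {0..T} \<phi>" using h by (intro continuous_on_subset[OF \<phi>_cont]) auto
  have 1: "continuous_on {0..T} (\<lambda>t. \<phi> (t - h))"
    by (rule continuous_on_compose2[OF \<phi>_cont]) (use h in \<open>auto intro!: continuous_intros\<close>)
  have 2: "continuous_on {0..T} (\<lambda>t. z (max 0 (t - h)))"
    by (rule continuous_on_compose2[OF z]) (use h in \<open>auto intro!: continuous_intros\<close>)
  have "continuous_on {0..T} (\<lambda>t. (\<lambda>(t, x). f t x) (t, \<phi> t + z t))"
    by (rule continuous_on_compose2[OF f_cont]) (auto intro!: continuous_intros \<phi> z)
  then have "continuous_on {0..T} (\<lambda>t. f t (\<phi> t + z t))" by simp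
  then show ?thesis unfolding forcing_def
    by (intro continuous_intros 1 2 continuous_on_subset[OF Q1_cont sub] continuous_on_subset[OF P2_cont sub])
qed

lemma continuous_on_picard:
  assumes "continuous_on {0..T} z"
  shows "continuous_on {0..T} (picard z)"
  unfolding picard_def[abs_def] using \<alpha>1 \<alpha>\<beta> assms
  by (intro continuous_intros continuous_on_RL_integral continuous_on_forcing) auto

lemma picard_0: "picard z 0 = 0"
  using \<alpha>1 \<alpha>\<beta> by (simp add: picard_def)

text \<open>A weight exponent for which the bounds of \<open>exp_weighted_RL_bound\<close> for the two integrals add up to at
  most \<open>1 / 2\<close>. The final \<open>1\<close> only makes it positive.\<close>

definition rate :: real where
  "rate = 2 * (\<bar>lam\<bar> * (T powr (\<alpha> - \<beta> - 1) / Gamma (\<alpha> - \<beta>)) +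
             (\<bar>\<mu>\<bar> + L) * (T powr (\<alpha> - 1) / Gamma \<alpha>)) + 1"

lemma picard_contracts:
  assumes z: "continuous_on {0..T} z" and w: "continuous_on {0..T} w"
    and C: "\<And>s. s \<in> {0..T} \<Longrightarrow> \<bar>z s - w s\<bar> \<le> C * exp (rate * s)" and t: "t \<in> {0..T}"
  shows "\<bar>picard z t - picard w t\<bar> \<le> C / 2 * exp (rate * t)"
proof -
  define A where "A = T powr (\<alpha> - \<beta> - 1) / Gamma (\<alpha> - \<beta>)"
  define B where "B = T powr (\<alpha> - 1) / Gamma \<alpha>"
  have "0 < Gamma \<alpha>" "0 < Gamma (\<alpha> - \<beta>)" using \<alpha>1 \<alpha>\<beta> by (auto intro!: Gamma_real_pos)
  then have AB: "0 \<le> A" "0 \<le> B" by (auto simp: A_def B_def)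
  have r: "rate = 2 * (\<bar>lam\<bar> * A + (\<bar>\<mu>\<bar> + L) * B) + 1" by (simp add: rate_def A_def B_def)
  then have r0: "0 < rate" using AB L by (auto intro!: add_nonneg_pos)
  have C0: "0 \<le> C" using C[of 0] T by (auto intro: order_trans[OF abs_ge_zero])
  have ct: "continuous_on {0..t} g" if "continuous_on {0..T} g" for g :: "real \<Rightarrow> real"
    using that t by (auto elim: continuous_on_subset)
  have 1: "\<bar>RL_integral 0 (\<alpha> - \<beta>) (\<lambda>s. z s - w s) t\<bar> \<le> A * (C / rate * exp (rate * t))"
    unfolding A_def using \<alpha>\<beta> r0 t C by (intro exp_weighted_RL_bound ct continuous_on_diff z w) auto
  have G: "\<bar>forcing z s - forcing w s\<bar> \<le> (\<bar>\<mu>\<bar> + L) * C * exp (rate * s)" if s: "s \<in> {0..T}" for s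
  proof -
    have m: "max 0 (s - h) \<in> {0..T}" "max 0 (s - h) \<le> s" using s h by auto
    have "\<bar>z (max 0 (s - h)) - w (max 0 (s - h))\<bar> \<le> C * exp (rate * max 0 (s - h))" by (rule C[OF m(1)])
    also have "\<dots> \<le> C * exp (rate * s)" using C0 r0 m(2) by (intro mult_left_mono) auto
    finally have "\<bar>\<mu>\<bar> * \<bar>z (max 0 (s - h)) - w (max 0 (s - h))\<bar> \<le> \<bar>\<mu>\<bar> * (C * exp (rate * s))"
      by (rule mult_left_mono) simp
    moreover have "\<bar>f s (\<phi> s + z s) - f s (\<phi> s + w s)\<bar> \<le> L * (C * exp (rate * s))"
      using f_Lipschitz[OF s, of "\<phi> s + z s" "\<phi> s + w s"] C[OF s] L
      by (auto elim!: order_trans intro!: mult_left_mono)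
    moreover have "forcing z s - forcing w s = \<mu> * (z (max 0 (s - h)) - w (max 0 (s - h)))
        + (f s (\<phi> s + z s) - f s (\<phi> s + w s))"
      by (simp add: forcing_def algebra_simps)
    ultimately show ?thesis
      using abs_triangle_ineq[of "\<mu> * (z (max 0 (s - h)) - w (max 0 (s - h)))" "f s (\<phi> s + z s) - f s (\<phi> s + w s)"]
      by (simp add: abs_mult distrib_right mult.assoc)
  qed
  have 2: "\<bar>RL_integral 0 \<alpha> (\<lambda>s. forcing z s - forcing w s) t\<bar> \<le> B * ((\<bar>\<mu>\<bar> + L) * C / rate * exp (rate * t))"
    unfolding B_def using \<alpha>1 r0 t G by (intro exp_weighted_RL_bound ct continuous_on_diff continuous_on_forcing z w) auto
  have "RL_integral 0 (\<alpha> - \<beta>) (\<lambda>s. z s - w s) t = RL_integral 0 (\<alpha> - \<beta>) z t - RL_integral 0 (\<alpha> - \<beta>) w t"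
    "RL_integral 0 \<alpha> (\<lambda>s. forcing z s - forcing w s) t = RL_integral 0 \<alpha> (forcing z) t - RL_integral 0 \<alpha> (forcing w) t"
    using \<alpha>1 \<alpha>\<beta> by (auto intro!: RL_integral_diff ct continuous_on_forcing z w)
  then have "picard z t - picard w t = lam * RL_integral 0 (\<alpha> - \<beta>) (\<lambda>s. z s - w s) t
      + RL_integral 0 \<alpha> (\<lambda>s. forcing z s - forcing w s) t"
    by (simp add: picard_def right_diff_distrib)
  then have "\<bar>picard z t - picard w t\<bar> \<le> \<bar>lam\<bar> * \<bar>RL_integral 0 (\<alpha> - \<beta>) (\<lambda>s. z s - w s) t\<bar>
      + \<bar>RL_integral 0 \<alpha> (\<lambda>s. forcing z s - forcing w s) t\<bar>"
    using abs_triangle_ineq[of "lam * RL_integral 0 (\<alpha> - \<beta>) (\<lambda>s. z s - w s) t"] by (simp add: abs_mult)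
  also have "\<dots> \<le> \<bar>lam\<bar> * (A * (C / rate * exp (rate * t))) + B * ((\<bar>\<mu>\<bar> + L) * C / rate * exp (rate * t))"
    by (rule add_mono[OF mult_left_mono[OF 1 abs_ge_zero] 2])
  also have "\<dots> = (\<bar>lam\<bar> * A + (\<bar>\<mu>\<bar> + L) * B) / rate * (C * exp (rate * t))"
    by (simp add: add_divide_distrib distrib_left distrib_right mult_ac)
  also have "\<dots> \<le> 1 / 2 * (C * exp (rate * t))"
  proof (rule mult_right_mono)
    show "(\<bar>lam\<bar> * A + (\<bar>\<mu>\<bar> + L) * B) / rate \<le> 1 / 2"
      using r r0 by (simp add: divide_le_eq)
  qed (use C0 in simp)
  finally show ?thesis by simp
qed

lemma RL_integral_decomposition:
  assumes y: "\<And>s. s \<in> {-h..T} \<Longrightarrow> y s = \<phi> s + zero_extension z s" and z: "continuous_on {0..T} z" "z 0 = 0"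
    and \<nu>: "0 \<le> \<nu>" and t: "t \<in> {-h..T}"
  shows "RL_integral (-h) \<nu> y t = RL_integral (-h) \<nu> \<phi> t + zero_extension (RL_integral 0 \<nu> z) t"
proof -
  have "RL_integral (-h) \<nu> y t = RL_integral (-h) \<nu> (\<lambda>s. \<phi> s + zero_extension z s) t"
    using t by (intro RL_integral_cong) (auto simp: y)
  also have "\<dots> = RL_integral (-h) \<nu> \<phi> t + RL_integral (-h) \<nu> (zero_extension z) t"
    using t by (intro RL_integral_add \<nu> continuous_on_subset[OF \<phi>_cont] continuous_on_subset[OF continuous_on_zero_extension[OF z]]) auto
  finally show ?thesis using h \<nu> z by (simp add: RL_integral_zero_extension)
qed


text \<open>The one delicate point is \<open>t = 0\<close>. The equation holds only for \<open>t > 0\<close>, so integrating it leaves a constant \<open>c\<close>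
  in the first derivative of \<open>v = I\<^bsup>2-\<alpha>\<^esup> z\<close>. Integrating again gives \<open>v t = I\<^sup>1 k t + c t\<close> up to \<open>t = 0\<close>, and
  the derivative of \<open>v\<close> at \<open>0\<close>, which the history condition prescribes, shows \<open>c = 0\<close>.\<close>

lemma solution_imp_fixed_point:
  assumes sol: "delay_problem_solution h T \<alpha> \<beta> lam \<mu> \<phi> f y" and y: "continuous_on {0..T} y"
    and t: "t \<in> {0..T}"
  shows "picard (\<lambda>s. y s - \<phi> s) t = y t - \<phi> t"
proof (cases "t = 0")
  case True
  have "y 0 = \<phi> 0" using sol h by (auto simp: delay_problem_solution_def)
  then show ?thesis using True by (simp add: picard_0)
next
  case False
  then have T0: "0 < T" using t by simp
  define S where "S = {-h<..T}"
  define z where "z = (\<lambda>s. y s - \<phi> s)"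
  define G where "G = forcing z"
  define q where "q = RL_integral 0 (1 - \<beta>) z"
  define v where "v = RL_integral 0 (2 - \<alpha>) z"
  define u where "u = RL_integral (-h) (2 - \<alpha>) y"
  have y\<phi>: "y s = \<phi> s" if "s \<in> {-h..0}" for s using sol that by (auto simp: delay_problem_solution_def)
  have z: "continuous_on {0..T} z" "z 0 = 0"
    unfolding z_def using h y\<phi> by (auto intro!: continuous_intros y continuous_on_subset[OF \<phi>_cont])
  have yz: "y s = \<phi> s + zero_extension z s" if "s \<in> {-h..T}" for s
    using y\<phi>[of s] that by (auto simp: z_def zero_extension_def)
  have dec: "RL_integral (-h) \<nu> y s - RL_integral (-h) \<nu> \<phi> s = RL_integral 0 \<nu> z s" if "0 \<le> \<nu>" "s \<in> {0..T}" for \<nu> s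
    using RL_integral_decomposition[OF yz z that(1), of s] that h z(2)
    by (cases "\<nu> = 0") (auto simp: zero_extension_def RL_integral_before_start)
  have G: "continuous_on {0..T} G" unfolding G_def by (rule continuous_on_forcing[OF z(1)])
  have q: "continuous_on {0..T} q" "q 0 = 0"
    unfolding q_def using \<beta> z by (auto intro!: continuous_on_RL_integral)
  have v: "continuous_on {0..T} v" "v 0 = 0"
    unfolding v_def using \<alpha> z by (auto intro!: continuous_on_RL_integral) (cases "\<alpha> = 2"; simp)+
  have S: "t \<in> S" "{0..T} \<subseteq> S" if "t \<in> {0..T}" for t using that h by (auto simp: S_def)
  let ?du = "deriv_within S u"

  have a1: "0 < \<alpha> - 1" "\<alpha> - 1 \<le> 1" using \<alpha> \<alpha>1 by auto
  have du: "(u has_real_derivative ?du s) (at s within S)" if s: "s \<in> {0..T}" for s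
  proof (rule has_derivative_deriv_within, cases "s = 0")
    case True
    have "RL_differentiable (-h) T (\<alpha> - 1) y 0" using sol h by (auto simp: delay_problem_solution_def)
    then show "u differentiable (at s within S)"
      using True by (simp add: RL_deriv_order_1[OF a1] u_def S_def)
  next
    case False
    then have "RL_differentiable (-h) T \<alpha> y s" using sol s by (auto simp: delay_problem_solution_def)
    then have "\<forall>\<^sub>F r in nhds s. r \<in> S \<longrightarrow> u differentiable (at r within S)"
      by (simp add: RL_deriv_order_2[OF \<alpha>1 \<alpha>] u_def S_def)
    from eventually_nhds_x_imp_x[OF this] show "u differentiable (at s within S)" using S s by blast
  qed
  have du0: "?du 0 = P1 0"
  proof -
    have "RL_deriv (-h) T (\<alpha> - 1) y 0 = RL_deriv (-h) T (\<alpha> - 1) \<phi> 0"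
      using sol h by (auto simp: delay_problem_solution_def)
    moreover have "deriv_within S (RL_integral (-h) (2 - \<alpha>) \<phi>) 0 = P1 0"
      unfolding S_def using T h by (intro deriv_within_eq P1) auto
    ultimately show ?thesis by (simp add: RL_deriv_order_2 RL_deriv_order_1[OF a1] u_def S_def)
  qed
  have dv: "(v has_real_derivative ?du s - P1 s) (at s within {0..T})" if s: "s \<in> {0..T}" for s
  proof -
    have "((\<lambda>r. u r - RL_integral (-h) (2 - \<alpha>) \<phi> r) has_real_derivative ?du s - P1 s) (at s within S)"
      using S(1)[OF s] by (intro DERIV_diff du s) (auto simp: S_def intro: P1)
    then have "((\<lambda>r. u r - RL_integral (-h) (2 - \<alpha>) \<phi> r) has_real_derivative ?du s - P1 s) (at s within {0..T})"
      by (rule DERIV_subset) (use S s in auto)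
    then show ?thesis
      by (rule has_field_derivative_transform_within[where d = 1])
        (use s \<alpha> dec[of "2 - \<alpha>"] in \<open>auto simp: u_def v_def\<close>)
  qed
  \<comment> \<open>The fractional equation, integrated once: \<open>D\<close> is constant to the right of \<open>0\<close>.\<close>
  define D where "D = (\<lambda>s. ?du s - P1 s - lam * q s - RL_integral 0 1 G s)"
  have "(D has_real_derivative 0) (at s within {0<..T})" if s: "s \<in> {0<..T}" for s
  proof -
    have s0: "s \<in> {0..T}" using s by auto
    have e: "RL_deriv (-h) T \<alpha> y s - lam * RL_deriv (-h) T \<beta> y s = \<mu> * y (s - h) + f s (y s)"
      and "RL_differentiable (-h) T \<alpha> y s" and b: "RL_differentiable (-h) T \<beta> y s"
      using sol s by (auto simp: delay_problem_solution_def)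
    then have "(?du has_real_derivative RL_deriv (-h) T \<alpha> y s) (at s within S)"
      using has_derivative_deriv_within[of ?du s S] by (simp add: RL_deriv_order_2[OF \<alpha>1 \<alpha>] u_def S_def)
    moreover have "(RL_integral (-h) (1 - \<beta>) y has_real_derivative RL_deriv (-h) T \<beta> y s) (at s within S)"
      using b has_derivative_deriv_within[of _ s S] \<beta> by (simp add: RL_deriv_order_1 S_def)
    moreover have "(RL_integral 0 1 G has_real_derivative G s) (at s within {0<..T})"
      using s by (intro DERIV_subset[OF RL_integral_1_has_derivative[OF G]]) auto
    moreover have "(P1 has_real_derivative P2 s) (at s within S)"
      "(RL_integral (-h) (1 - \<beta>) \<phi> has_real_derivative Q1 s) (at s within S)"
      using S(1)[OF s0] by (auto simp: S_def intro: P2 Q1)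
    moreover have "{0<..T} \<subseteq> S" using h by (auto simp: S_def)
    ultimately have "((\<lambda>r. ?du r - P1 r - lam * (RL_integral (-h) (1 - \<beta>) y r - RL_integral (-h) (1 - \<beta>) \<phi> r)
        - RL_integral 0 1 G r) has_real_derivative
        RL_deriv (-h) T \<alpha> y s - P2 s - lam * (RL_deriv (-h) T \<beta> y s - Q1 s) - G s) (at s within {0<..T})"
      by (intro DERIV_diff DERIV_cmult) (auto intro: DERIV_subset)
    moreover have "\<phi> (s - h) + z (max 0 (s - h)) = y (s - h)"
      using yz[of "s - h"] s h z(2) by (auto simp: zero_extension_def max_def)
    then have "G s = lam * Q1 s - P2 s + \<mu> * y (s - h) + f s (y s)"
      by (simp add: G_def forcing_def) (simp add: z_def)
    then have "RL_deriv (-h) T \<alpha> y s - P2 s - lam * (RL_deriv (-h) T \<beta> y s - Q1 s) - G s = 0"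
      using e by (simp add: algebra_simps)
    ultimately have "((\<lambda>r. ?du r - P1 r - lam * (RL_integral (-h) (1 - \<beta>) y r - RL_integral (-h) (1 - \<beta>) \<phi> r)
        - RL_integral 0 1 G r) has_real_derivative 0) (at s within {0<..T})"
      by (simp only:)
    then show ?thesis
    proof (rule has_field_derivative_transform_within[where d = 1])
      show "?du r - P1 r - lam * (RL_integral (-h) (1 - \<beta>) y r - RL_integral (-h) (1 - \<beta>) \<phi> r)
        - RL_integral 0 1 G r = D r" if "r \<in> {0<..T}" for r
        using dec[of "1 - \<beta>" r] that \<beta> by (simp add: D_def q_def)
    qed (use s in auto)
  qed
  then obtain c where c: "\<And>s. s \<in> {0<..T} \<Longrightarrow> D s = c"
    using has_field_derivative_zero_constant[of "{0<..T}" D] by auto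
  define k where "k = (\<lambda>s. lam * q s + RL_integral 0 1 G s)"
  have k: "continuous_on {0..T} k" "k 0 = 0"
    unfolding k_def using G q by (auto intro!: continuous_intros continuous_on_RL_integral)
  define M where "M = (\<lambda>s. v s - RL_integral 0 1 k s - c * s)"
  have M: "(M has_real_derivative ?du s - P1 s - k s - c) (at s within {0..T})" if "s \<in> {0..T}" for s
    unfolding M_def using that
    by (auto intro!: derivative_eq_intros dv RL_integral_1_has_derivative k)
  have M0: "M s = 0" if s: "s \<in> {0..T}" for s
  proof (rule has_derivative_zero_unique_strong_interval[of "{0}" 0 T M 0 s])
    show "continuous_on {0..T} M" using M by (rule DERIV_continuous_on)
    show "M 0 = 0" using v by (simp add: M_def)
    show "(M has_derivative (\<lambda>h. 0)) (at x within {0..T})" if "x \<in> {0..T} - {0}" for x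
    proof -
      have "?du x - P1 x - k x - c = 0" using c[of x] that by (simp add: D_def k_def)
      then show ?thesis using M[of x] that by (simp add: has_field_derivative_def lambda_zero[symmetric] mult_zero_left[abs_def])
    qed
  qed (use s in auto)
  have "(M has_real_derivative - c) (at 0 within {0..T})" using M[of 0] T du0 k by simp
  moreover have "(M has_real_derivative 0) (at 0 within {0..T})"
    by (rule has_field_derivative_transform_within[where f = "\<lambda>_. 0" and d = 1]) (use T M0 in auto)
  ultimately have "c = 0"
    using vector_derivative_unique_within_closed_interval[of 0 T 0 M "- c" 0] T0
    by (simp add: has_real_derivative_iff_has_vector_derivative)
  then have vk: "v s = RL_integral 0 1 k s" if "s \<in> {0..T}" for s
    using M0[OF that] by (simp add: M_def)

  \<comment> \<open>Apply the integral of order \<open>\<alpha> - 1\<close> to \<open>v = I\<^sup>1 k\<close>; differentiating the result gives the claim.\<close>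
  have "RL_integral 0 1 z s = RL_integral 0 1 (picard z) s" if s: "s \<in> {0..T}" for s
  proof -
    have sub: "continuous_on {0..s} g" if "continuous_on {0..T} g" for g :: "real \<Rightarrow> real"
      using that s by (auto elim: continuous_on_subset)
    have "RL_integral 0 1 z s = RL_integral 0 (\<alpha> - 1) v s"
      unfolding v_def using s \<alpha> \<alpha>1 by (simp add: RL_integral_RL_integral[OF _ _ z(1)])
    also have "\<dots> = RL_integral 0 (\<alpha> - 1) (RL_integral 0 1 k) s"
      using s by (intro RL_integral_cong vk) auto
    also have "\<dots> = RL_integral 0 \<alpha> k s"
      using s \<alpha>1 by (simp add: RL_integral_RL_integral[OF _ _ k(1)])
    also have "\<dots> = lam * RL_integral 0 \<alpha> q s + RL_integral 0 \<alpha> (RL_integral 0 1 G) s"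
      unfolding k_def using \<alpha>1 
      by (subst RL_integral_add) (auto intro!: sub continuous_intros q continuous_on_RL_integral G simp: RL_integral_cmult)
    also have "\<dots> = lam * RL_integral 0 1 (RL_integral 0 (\<alpha> - \<beta>) z) s + RL_integral 0 1 (RL_integral 0 \<alpha> G) s"
      unfolding q_def using \<alpha>1 \<beta> \<alpha>\<beta> s
      by (simp add: RL_integral_RL_integral[OF _ _ z(1)] RL_integral_RL_integral[OF _ _ G] algebra_simps)
    also have "\<dots> = RL_integral 0 1 (picard z) s"
      unfolding picard_def[abs_def] G_def[symmetric] using \<alpha>1 \<alpha>\<beta>
      by (subst RL_integral_add) (auto intro!: sub continuous_intros z continuous_on_RL_integral G simp: RL_integral_cmult)
    finally show ?thesis .
  qed
  note eq = this
  have "(RL_integral 0 1 z has_real_derivative z t) (at t within {0..T})"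
    using t by (intro RL_integral_1_has_derivative z)
  moreover have "(RL_integral 0 1 z has_real_derivative picard z t) (at t within {0..T})"
    by (rule has_field_derivative_transform_within[where d = 1,
        OF RL_integral_1_has_derivative[OF continuous_on_picard[OF z(1)] t]]) (use t eq in auto)
  ultimately have "picard z t = z t"
    using vector_derivative_unique_within_closed_interval[of 0 T t "RL_integral 0 1 z" "picard z t" "z t"] T0 t
    by (simp add: has_real_derivative_iff_has_vector_derivative)
  then show ?thesis by (simp add: z_def)
qed

text \<open>The Volterra equation shows that the integrals of \<open>z\<close> of orders \<open>2 - \<alpha>\<close> and \<open>1 - \<beta>\<close> are antiderivatives of
  continuous functions \<open>k\<close> and \<open>q'\<close>. Here \<open>k 0 = 0\<close>, so the extension of \<open>k\<close> by zero is continuous and the integral of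
  order \<open>2 - \<alpha>\<close> of \<open>y\<close> is differentiable across \<open>0\<close> with the derivative required by the history. The order
  \<open>\<alpha> - 2 * \<beta>\<close> occurring in \<open>q'\<close> is positive because \<open>\<alpha> - \<beta> > 1 > \<beta>\<close>.\<close>

lemma fixed_point_imp_solution:
  assumes z: "continuous_on {0..T} z" and fp: "\<And>t. t \<in> {0..T} \<Longrightarrow> picard z t = z t"
    and y: "\<And>t. t \<in> {-h..T} \<Longrightarrow> y t = \<phi> t + zero_extension z t"
  shows "delay_problem_solution h T \<alpha> \<beta> lam \<mu> \<phi> f y"
proof -
  define S where "S = {-h<..T}"
  have z0: "z 0 = 0" using fp[of 0] T picard_0[of z] by simp
  define G where "G = forcing z"
  define q where "q = RL_integral 0 (1 - \<beta>) z"
  define q' where "q' = (\<lambda>s. lam * RL_integral 0 (\<alpha> - 2 * \<beta>) z s + RL_integral 0 (\<alpha> - \<beta>) G s)"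
  define k where "k = (\<lambda>s. lam * q s + RL_integral 0 1 G s)"
  have a2b: "0 < \<alpha> - 2 * \<beta>" using \<alpha>\<beta> \<beta> by simp
  have a1: "0 < \<alpha> - 1" "\<alpha> - 1 \<le> 1" using \<alpha> \<alpha>1 by auto
  have G: "continuous_on {0..T} G" unfolding G_def by (rule continuous_on_forcing[OF z])
  have q: "continuous_on {0..T} q" "q 0 = 0"
    unfolding q_def using \<beta> z by (auto intro!: continuous_on_RL_integral)
  have q': "continuous_on {0..T} q'"
    unfolding q'_def using \<alpha>\<beta> a2b z G by (intro continuous_intros continuous_on_RL_integral) auto
  have k: "continuous_on {0..T} k" "k 0 = 0"
    unfolding k_def using G q by (auto intro!: continuous_intros continuous_on_RL_integral)
  have sub: "continuous_on {0..s} g" if "s \<in> {0..T}" "continuous_on {0..T} g" for s and g :: "real \<Rightarrow> real"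
    using that by (auto elim: continuous_on_subset)
  \<comment> \<open>Integrating the Volterra equation shows that integrals of \<open>z\<close> are as smooth as integrals of higher order.\<close>
  have Jz: "RL_integral 0 \<nu> z s = lam * RL_integral 0 (\<nu> + \<alpha> - \<beta>) z s + RL_integral 0 (\<nu> + \<alpha>) G s"
    if "0 \<le> \<nu>" and s: "s \<in> {0..T}" for \<nu> s
  proof -
    have "RL_integral 0 \<nu> z s = RL_integral 0 \<nu> (\<lambda>s. lam * RL_integral 0 (\<alpha> - \<beta>) z s + RL_integral 0 \<alpha> G s) s"
      using s fp by (intro RL_integral_cong) (auto simp: picard_def G_def)
    also have "\<dots> = lam * RL_integral 0 \<nu> (RL_integral 0 (\<alpha> - \<beta>) z) s + RL_integral 0 \<nu> (RL_integral 0 \<alpha> G) s"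
      using that \<alpha>1 \<alpha>\<beta>
      by (subst RL_integral_add) (auto intro!: sub[OF s] continuous_intros z continuous_on_RL_integral G simp: RL_integral_cmult)
    finally show ?thesis using that \<alpha>1 \<alpha>\<beta>
      by (simp add: RL_integral_RL_integral[OF _ _ z] RL_integral_RL_integral[OF _ _ G] add_diff_eq)
  qed
  have q_eq: "q s = RL_integral 0 1 q' s" if s: "s \<in> {0..T}" for s
  proof -
    have "RL_integral 0 1 q' s = lam * RL_integral 0 1 (RL_integral 0 (\<alpha> - 2 * \<beta>) z) s + RL_integral 0 1 (RL_integral 0 (\<alpha> - \<beta>) G) s"
      unfolding q'_def using a2b \<alpha>\<beta>
      by (subst RL_integral_add) (auto intro!: sub[OF s] continuous_intros z continuous_on_RL_integral G simp: RL_integral_cmult)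
    then show ?thesis unfolding q_def using Jz[of "1 - \<beta>" s] s \<beta> a2b \<alpha>\<beta>
      by (simp add: RL_integral_RL_integral[OF _ _ z] RL_integral_RL_integral[OF _ _ G] algebra_simps)
  qed
  have v_eq: "RL_integral 0 (2 - \<alpha>) z s = RL_integral 0 1 k s" if s: "s \<in> {0..T}" for s
  proof -
    have "RL_integral 0 1 k s = lam * RL_integral 0 1 q s + RL_integral 0 1 (RL_integral 0 1 G) s"
      unfolding k_def
      by (subst RL_integral_add) (auto intro!: sub[OF s] continuous_intros q continuous_on_RL_integral G simp: RL_integral_cmult)
    then show ?thesis unfolding q_def using Jz[of "2 - \<alpha>" s] s \<beta> \<alpha>
      by (simp add: RL_integral_RL_integral[OF _ _ z] RL_integral_RL_integral[OF _ _ G])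
  qed
  have dec: "RL_integral (-h) \<nu> y s = RL_integral (-h) \<nu> \<phi> s + zero_extension (RL_integral 0 \<nu> z) s"
    if "0 \<le> \<nu>" "s \<in> {-h..T}" for \<nu> s
    using RL_integral_decomposition[OF y z z0] that by simp

  have Iy: "(RL_integral (-h) (2 - \<alpha>) y has_real_derivative P1 s + zero_extension k s) (at s within S)" if s: "s \<in> S" for s
  proof -
    have "(RL_integral (-h) 1 (zero_extension k) has_real_derivative zero_extension k s) (at s within S)"
      using s by (intro DERIV_subset[OF RL_integral_1_has_derivative[OF continuous_on_zero_extension[OF k]]]) (auto simp: S_def)
    then have "((\<lambda>r. RL_integral (-h) (2 - \<alpha>) \<phi> r + RL_integral (-h) 1 (zero_extension k) r) has_real_derivative P1 s + zero_extension k s) (at s within S)"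
      using s by (intro DERIV_add) (auto simp: S_def intro: P1)
    then show ?thesis
      by (rule has_field_derivative_transform_within[where d = 1])
        (use s h \<alpha> k(2) v_eq in \<open>auto simp: S_def dec RL_integral_zero_extension zero_extension_def\<close>)
  qed
  have du: "deriv_within S (RL_integral (-h) (2 - \<alpha>) y) s = P1 s + zero_extension k s" if "s \<in> S" for s
    using Iy[OF that] that unfolding S_def by (rule deriv_within_eq)
  have d\<phi>: "deriv_within S (RL_integral (-h) (2 - \<alpha>) \<phi>) s = P1 s" if "s \<in> S" for s
    using P1[of s] that unfolding S_def by (intro deriv_within_eq) auto
  have D1: "RL_deriv (-h) T (\<alpha> - 1) y s = P1 s" "RL_deriv (-h) T (\<alpha> - 1) \<phi> s = P1 s" if "s \<in> {-h<..0}" for s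
    using du[of s] d\<phi>[of s] that T by (simp_all add: RL_deriv_order_1[OF a1] S_def zero_extension_def)

  have "RL_differentiable (-h) T \<alpha> y t \<and> RL_differentiable (-h) T \<beta> y t \<and>
        RL_deriv (-h) T \<alpha> y t - lam * RL_deriv (-h) T \<beta> y t = \<mu> * y (t - h) + f t (y t)"
    if t: "t \<in> {0<..T}" for t
  proof -
    have t0: "t \<in> {0..T}" and tS: "t \<in> S" using t h by (auto simp: S_def)
    have dq: "(q has_real_derivative q' t) (at t within {0..T})"
      by (rule has_field_derivative_transform_within[where d = 1, OF RL_integral_1_has_derivative[OF q' t0]])
        (use t0 q_eq in auto)
    have "(k has_real_derivative lam * q' t + G t) (at t within {0..T})"
      unfolding k_def by (intro DERIV_add DERIV_cmult dq RL_integral_1_has_derivative G t0)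
    then have "(zero_extension k has_real_derivative lam * q' t + G t) (at t within S)"
      unfolding S_def by (rule zero_extension_has_derivative) (use t h in auto)
    then have "((\<lambda>s. P1 s + zero_extension k s) has_real_derivative P2 t + (lam * q' t + G t)) (at t within S)"
      using tS by (intro DERIV_add) (auto simp: S_def intro: P2)
    then have A: "(deriv_within S (RL_integral (-h) (2 - \<alpha>) y) has_real_derivative P2 t + (lam * q' t + G t)) (at t within S)"
      by (rule has_field_derivative_transform_within[where d = 1]) (use tS du in auto)
    have "(zero_extension q has_real_derivative q' t) (at t within S)"
      unfolding S_def by (rule zero_extension_has_derivative[OF dq]) (use t h in auto)
    then have "((\<lambda>s. RL_integral (-h) (1 - \<beta>) \<phi> s + zero_extension q s) has_real_derivative Q1 t + q' t) (at t within S)"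
      using tS by (intro DERIV_add) (auto simp: S_def intro: Q1)
    then have B: "(RL_integral (-h) (1 - \<beta>) y has_real_derivative Q1 t + q' t) (at t within S)"
      by (rule has_field_derivative_transform_within[where d = 1])
        (use tS \<beta> in \<open>auto simp: S_def dec q_def\<close>)
    have "RL_differentiable (-h) T \<alpha> y t"
      using has_real_derivative_imp_differentiable[OF Iy] has_real_derivative_imp_differentiable[OF A]
      by (simp add: RL_deriv_order_2[OF \<alpha>1 \<alpha>] S_def)
    moreover have "RL_differentiable (-h) T \<beta> y t"
      using has_real_derivative_imp_differentiable[OF B] \<beta> by (simp add: RL_deriv_order_1 S_def)
    moreover have "RL_deriv (-h) T \<alpha> y t = P2 t + (lam * q' t + G t)"
      using deriv_within_eq[OF A[unfolded S_def]] tS by (simp add: RL_deriv_order_2[OF \<alpha>1 \<alpha>] S_def)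
    moreover have "RL_deriv (-h) T \<beta> y t = Q1 t + q' t"
      using deriv_within_eq[OF B[unfolded S_def]] tS \<beta> by (simp add: RL_deriv_order_1 S_def)
    moreover have "y (t - h) = \<phi> (t - h) + z (max 0 (t - h))" "y t = \<phi> t + z t"
      using y[of "t - h"] y[of t] t h z0 by (auto simp: zero_extension_def max_def)
    ultimately show ?thesis by (simp add: G_def forcing_def algebra_simps)
  qed
  moreover have "y t = \<phi> t" if "t \<in> {-h..0}" for t using y[of t] that T by (simp add: zero_extension_def)
  moreover have left: "\<forall>\<^sub>F s in at_right (-h). s \<in> {-h<..<0}"
    using h by (intro eventually_at_right_real) auto
  have "(RL_integral (-h) (2 - \<alpha>) y \<longlongrightarrow> \<phi> (-h)) (at_right (-h))"
  proof (rule Lim_transform_eventually[OF lim_integral])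
    show "\<forall>\<^sub>F s in at_right (-h). RL_integral (-h) (2 - \<alpha>) \<phi> s = RL_integral (-h) (2 - \<alpha>) y s"
      using left by eventually_elim (use \<alpha> T in \<open>simp add: dec zero_extension_def\<close>)
  qed
  moreover have "RL_differentiable (-h) T (\<alpha> - 1) y t" if "t \<in> {-h<..0}" for t
    using has_real_derivative_imp_differentiable[OF Iy[of t]] that T
    by (simp add: RL_deriv_order_1[OF a1] S_def)
  moreover have "\<exists>d. (RL_deriv (-h) T (\<alpha> - 1) \<phi> \<longlongrightarrow> d) (at_right (-h)) \<and>
          (RL_deriv (-h) T (\<alpha> - 1) y \<longlongrightarrow> d) (at_right (-h))"
  proof -
    obtain d where d: "(P1 \<longlongrightarrow> d) (at_right (-h))" using lim_deriv by blast
    have "(RL_deriv (-h) T (\<alpha> - 1) \<phi> \<longlongrightarrow> d) (at_right (-h))"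
      by (rule Lim_transform_eventually[OF d]) (use left in eventually_elim, use D1 in simp)
    moreover have "(RL_deriv (-h) T (\<alpha> - 1) y \<longlongrightarrow> d) (at_right (-h))"
      by (rule Lim_transform_eventually[OF d]) (use left in eventually_elim, use D1 in simp)
    ultimately show ?thesis by blast
  qed
  ultimately show ?thesis
    unfolding delay_problem_solution_def using D1 by auto
qed

theorem unique_solution:
  "\<exists>!y. y \<in> extensional {-h..T} \<and> continuous_on {0..T} y \<and> delay_problem_solution h T \<alpha> \<beta> lam \<mu> \<phi> f y"
proof -
  note fp = weighted_contraction_fixed_point[of T picard rate, OF T continuous_on_picard picard_contracts]
  obtain z where z: "continuous_on {0..T} z" and zf: "\<And>t. t \<in> {0..T} \<Longrightarrow> picard z t = z t"
    using fp(1) by blast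
  define y where "y = restrict (\<lambda>t. \<phi> t + zero_extension z t) {-h..T}"
  have z0: "z 0 = 0" using zf[of 0] T picard_0[of z] by simp
  have \<phi>: "continuous_on {0..T} \<phi>" using h by (intro continuous_on_subset[OF \<phi>_cont]) auto
  have "continuous_on {0..T} (\<lambda>t. \<phi> t + zero_extension z t)"
    by (intro continuous_on_add \<phi> continuous_on_zero_extension z z0)
  then have yc: "continuous_on {0..T} y"
    by (rule continuous_on_eq) (use h in \<open>auto simp: y_def\<close>)
  have ys: "delay_problem_solution h T \<alpha> \<beta> lam \<mu> \<phi> f y"
    by (rule fixed_point_imp_solution[OF z zf]) (auto simp: y_def)
  show ?thesis
  proof (rule ex1I[of _ y])
    show "y \<in> extensional {-h..T} \<and> continuous_on {0..T} y \<and> delay_problem_solution h T \<alpha> \<beta> lam \<mu> \<phi> f y"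
      using yc ys by (auto simp: y_def)
    fix x assume x: "x \<in> extensional {-h..T} \<and> continuous_on {0..T} x \<and> delay_problem_solution h T \<alpha> \<beta> lam \<mu> \<phi> f x"
    show "x = y"
    proof (rule extensionalityI[of _ "{-h..T}"])
      fix t assume t: "t \<in> {-h..T}"
      show "x t = y t"
      proof (cases "0 \<le> t")
        case True
        then have "x t - \<phi> t = y t - \<phi> t"
          using x t by (intro fp(2)[of "\<lambda>s. x s - \<phi> s" "\<lambda>s. y s - \<phi> s"] continuous_on_diff \<phi> yc
              solution_imp_fixed_point ys) auto
        then show ?thesis by simp
      next
        case False
        then show ?thesis using x ys t by (simp add: delay_problem_solution_def)
      qed
    qed (use x in \<open>auto simp: y_def\<close>)
  qed
qed

end

section \<open>Existence and uniqueness\<close>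

theorem theorem11:
  fixes h T \<alpha> \<beta> lam \<mu> L :: real
    and l :: nat
    and \<phi> :: "real \<Rightarrow> real"
    and f :: "real \<Rightarrow> real \<Rightarrow> real"
  assumes "h > 0"
    and "T = real l * h"
    and "0 < \<beta>" and "\<beta> < 1"
    and "1 < \<alpha>" and "\<alpha> \<le> 2"
    and "\<alpha> - \<beta> > 1"
    and "twice_cont_differentiable_on {-h..T} \<phi>"
    and "\<exists>d. (RL_deriv (-h) T (\<alpha> - 1) \<phi> \<longlongrightarrow> d) (at_right (-h))"
    and "continuous_on ({0..T} \<times> UNIV) (\<lambda>(t, x). f t x)"
    and "L > 0"
    and "\<And>t x z. t \<in> {0..T} \<Longrightarrow> \<bar>f t x - f t z\<bar> \<le> L * \<bar>x - z\<bar>"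
  shows "\<exists>!y. y \<in> extensional {-h..T} \<and> continuous_on {0..T} y \<and>
              delay_problem_solution h T \<alpha> \<beta> lam \<mu> \<phi> f y"
proof -
  have T: "0 \<le> T" "-h < T" using assms(1,2) by (simp_all add: add_pos_nonneg less_le_trans[of _ 0])
  obtain \<phi>' \<phi>'' where d1: "\<And>t. t \<in> {-h..T} \<Longrightarrow> (\<phi> has_real_derivative \<phi>' t) (at t within {-h..T})"
    and d2: "\<And>t. t \<in> {-h..T} \<Longrightarrow> (\<phi>' has_real_derivative \<phi>'' t) (at t within {-h..T})"
    and c2: "continuous_on {-h..T} \<phi>''"
    using assms(8) unfolding twice_cont_differentiable_on_def by blast
  have c0: "continuous_on {-h..T} \<phi>" using d1 by (rule DERIV_continuous_on)
  have c1: "continuous_on {-h..T} \<phi>'" using d2 by (rule DERIV_continuous_on)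
  define \<nu> where "\<nu> = 2 - \<alpha>"
  have \<nu>: "0 \<le> \<nu>" "\<nu> < 1" using assms by (auto simp: \<nu>_def)
  \<comment> \<open>The two cases of interest are \<open>\<kappa> = 2 - \<alpha>\<close> and \<open>\<kappa> = 1 - \<beta>\<close>.\<close>
  define D where "D = (\<lambda>\<kappa> t. \<kappa> * \<phi> (-h) / Gamma (\<kappa> + 1) * (t - (-h)) powr (\<kappa> - 1) + RL_integral (-h) \<kappa> \<phi>' t)"
  have D: "(RL_integral (-h) \<kappa> \<phi> has_real_derivative D \<kappa> t) (at t within {-h<..T})"
    if "0 \<le> \<kappa>" "t \<in> {-h<..T}" for \<kappa> t
    unfolding D_def using that by (intro RL_integral_of_C1_has_derivative d1 c1)
  define P2 where "P2 = (\<lambda>t. \<nu> * \<phi> (-h) / Gamma (\<nu> + 1) * ((\<nu> - 1) * (t - (-h)) powr (\<nu> - 2))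
    + (\<nu> * \<phi>' (-h) / Gamma (\<nu> + 1) * (t - (-h)) powr (\<nu> - 1) + RL_integral (-h) \<nu> \<phi>'' t))"
  have RLc: "continuous_on {-h<..T} (RL_integral (-h) \<kappa> g)" if "0 \<le> \<kappa>" "continuous_on {-h..T} g" for \<kappa> g
    using continuous_on_RL_integral[OF that] by (rule continuous_on_subset) auto
  have D_lim: "\<exists>d. (D \<nu> \<longlongrightarrow> d) (at_right (-h))"
  proof -
    obtain d where d: "(RL_deriv (-h) T (\<alpha> - 1) \<phi> \<longlongrightarrow> d) (at_right (-h))" using assms(9) by blast
    have "(D \<nu> \<longlongrightarrow> d) (at_right (-h))"
    proof (rule Lim_transform_eventually[OF d])
      show "\<forall>\<^sub>F t in at_right (-h). RL_deriv (-h) T (\<alpha> - 1) \<phi> t = D \<nu> t"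
        using eventually_at_right_real[OF T(2)]
      proof eventually_elim
        case (elim t)
        then have "deriv_within {-h<..T} (RL_integral (-h) (2 - \<alpha>) \<phi>) t = D \<nu> t"
          using D[of \<nu> t] \<nu> by (intro deriv_within_eq) (auto simp: \<nu>_def)
        then show ?case using assms(5,6) by (simp add: RL_deriv_order_1)
      qed
    qed
    then show ?thesis ..
  qed
  interpret delay_equation h T \<alpha> \<beta> lam \<mu> L \<phi> "D \<nu>" P2 "D (1 - \<beta>)" f
  proof (unfold_locales)
    show "(RL_integral (-h) (2 - \<alpha>) \<phi> has_real_derivative D \<nu> t) (at t within {-h<..T})" if "t \<in> {-h<..T}" for t
      using D[of \<nu> t] that \<nu> by (simp add: \<nu>_def)
    show "(RL_integral (-h) (1 - \<beta>) \<phi> has_real_derivative D (1 - \<beta>) t) (at t within {-h<..T})" if "t \<in> {-h<..T}" for t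
      using D[of "1 - \<beta>" t] that assms by simp
    show "(D \<nu> has_real_derivative P2 t) (at t within {-h<..T})" if t: "t \<in> {-h<..T}" for t
    proof -
      have "((\<lambda>t. (t - (-h)) powr (\<nu> - 1)) has_real_derivative (\<nu> - 1) * (t - (-h)) powr (\<nu> - 2)) (at t within {-h<..T})"
        using t by (auto intro!: derivative_eq_intros)
      then show ?thesis unfolding D_def P2_def
        by (intro DERIV_add DERIV_cmult RL_integral_of_C1_has_derivative[OF d2 c2 \<nu>(1) t])
    qed
    show "continuous_on {-h<..T} P2" unfolding P2_def
      using \<nu> by (intro continuous_intros continuous_on_powr_shift RLc c2) 
    show "continuous_on {-h<..T} (D (1 - \<beta>))" unfolding D_def
      using assms by (intro continuous_on_add continuous_on_mult_left continuous_on_powr_shift RLc c1) auto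
    show "(RL_integral (-h) (2 - \<alpha>) \<phi> \<longlongrightarrow> \<phi> (-h)) (at_right (-h))"
    proof -
      \<comment> \<open>For \<open>\<nu> > 0\<close> the left side is \<open>0\<close>, so this needs \<open>\<phi> (-h) = 0\<close>.\<close>
      have "RL_integral (-h) \<nu> \<phi> (-h) = \<phi> (-h)"
      proof (cases "\<nu> = 0")
        case False
        then have "\<phi> (-h) = 0"
        proof -
          obtain d where d: "(D \<nu> \<longlongrightarrow> d) (at_right (-h))" using D_lim by blast
          show ?thesis
            by (rule vanishes_if_RL_deriv_limit[OF T(2) d1 c1 _ _ d[unfolded D_def]])
              (use \<open>\<nu> \<noteq> 0\<close> \<nu> in auto)
        qed
        then show ?thesis using False \<nu> by simp
      qed simp
      moreover have "(RL_integral (-h) \<nu> \<phi> \<longlongrightarrow> RL_integral (-h) \<nu> \<phi> (-h)) (at_right (-h))"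
        using continuous_on_RL_integral[OF \<nu>(1) c0] T
        by (auto simp: continuous_on_def at_within_Icc_at_right dest!: bspec[of _ _ "-h"])
      ultimately show ?thesis by (simp add: \<nu>_def)
    qed
  qed (use assms T c0 D_lim in auto)
  show ?thesis by (rule unique_solution)
qed

end
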